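(* Consider the simplified game of baccara banque with parameter $\theta\in(0,1/2]$ (see context). Let $\theta_*\approx 0.496088$ be the root in $(0.49,0.5)$ of $6896169-1190915420\,\theta+3549548480\,\theta^2-2372477184\,\theta^3$. For every $\theta\in(\theta_*,1/2]$ the correlated cooperative equilibrium is as follows, and it is unique in behavioral strategies. Let $D(\theta)=901-443072\,\theta(1-\theta)$. The Players' strategy is $$\boldsymbol p(\theta)=(p_{00},p_{01},p_{10},p_{11})=\Big(0,\ \tfrac{10(-3171-17332\theta+20640\theta^2)}{3D(\theta)},\ \tfrac{10(137-23948\theta+20640\theta^2)}{3D(\theta)},\ \tfrac{33043-916416\,\theta(1-\theta)}{3D(\theta)}\Big).$$ Banker draws or stands as prescribed by Table 1 (see context), mixing only on $(6,10,6)$ and $(10,6,6)$, where $$P(\text{Banker draws on }(6,10,6))=\frac{21311777-393439433\,\theta+620812136\,\theta^2}{208\,D(\theta)},$$ $$P(\text{Banker draws on }(10,6,6))=\frac{248684480-848184839\,\theta+620812136\,\theta^2}{208\,D(\theta)}.$$ The value of the game (to the Players) is $$v(\theta)=-\frac{80\,[2421541645-515181045616\,\theta(1-\theta)]}{13^9\,D(\theta)}.$$ In particular, for $\theta=1/2$ one has $\boldsymbol p=(0,\frac{110}{543},\frac{110}{543},\frac{323}{543})$, both mixing probabilities equal $5121/5792$, and the value is $-16655514960/(181\cdot 13^9)$.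
   Context: Simplified game of baccara banque. Let $X_1,X_2,Y$ be i.i.d. on $\{0,\ldots,9\}$ with $P(\cdot=i)=q(i)=(16+9\delta_{i,0})/13^2$ (two-card totals of Player 1, Player 2, Banker), and let $X_1',X_2',Y'$ be i.i.d. on $\{0,\ldots,9\}$, independent of these, with $P(\cdot=k)=q'(k)=(1+3\delta_{k,0})/13$ (third-card values). $M(i)$ is the remainder of $i$ modulo $10$. Player $i$'s pure strategies are $u_i\in\{0,1\}$ ($0$ = stand on two-card total 5, $1$ = draw on 5); Player $i$ draws iff $X_i\le 4+u_i$. Put $K_i=X_i'$ if $X_i\le 4+u_i$, $K_i=10$ if $5+u_i\le X_i\le 7$ (stand), $K_i=11$ if $X_i\in\{8,9\}$ (natural); put $F_i=M(X_i+X_i')$ if $X_i\le 4+u_i$ and $F_i=X_i$ otherwise. Banker's information sets are the 1144 triples $(k_1,k_2,j)\in I:=[\{0,\ldots,11\}^2\setminus\{(11,11)\}]\times\{0,\ldots,7\}$; a Banker pure strategy is a subset $T\subset I$, the set on which he draws. If $Y\ge 8$ or both $X_1,X_2\ge 8$, set $G_i=\mathrm{sgn}(X_i-Y)$. Otherwise let $B=M(Y+Y')$ if $(K_1,K_2,Y)\in T$ and $B=Y$ if not, and set $G_i=1$ if $X_i\ge 8$ and $G_i=\mathrm{sgn}(F_i-B)$ if $X_i\le 7$. The joint payoff to the Players is $a_{u_1,u_2,T}(\theta)=E[\theta G_1+(1-\theta)G_2]$; the payoff to Banker is $-a_{u_1,u_2,T}(\theta)$. A behavioral strategy of Banker is a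 map $\beta:I\to[0,1]$, $\beta(k_1,k_2,j)$ being the probability of drawing at $(k_1,k_2,j)$; since at most one information set is met per play, every mixed strategy over subsets $T$ is payoff-equivalent to the behavioral strategy of its marginal drawing probabilities. A correlated cooperative equilibrium is a solution (maximin strategy, minimax strategy) of the two-person zero-sum $2^2\times 2^{1144}$ matrix game with payoffs $a_{u_1,u_2,T}(\theta)$ to the coalition of the two Players against Banker, where the coalition may use any mixture $\boldsymbol p=(p_{00},p_{01},p_{10},p_{11})$ of $(u_1,u_2)=(0,0),(0,1),(1,0),(1,1)$. Table 1 (Banker's maximum drawing total as a function of $k_1$ (row) and $k_2$ (column), columns $k_2=0,1,\ldots,11$). An entry $m$ means: draw on $j\le m$, stand on $j>m$. An entry $5{+}$ means: draw on $j\le 5$, mix on $j=6$, stand on $j=7$. $k_1=0$: 3,3,3,4,4,4,4,3,3,3,5,3; $k_1=1$: 3,3,4,4,4,4,4,4,3,3,5,3; $k_1=2$: 3,4,4,4,4,4,5,4,3,3,5,4; $k_1=3$: 4,4,4,4,4,5,5,4,4,3,5,4; $k_1=4$: 4,4,4,4,5,5,5,5,4,4,5,5; $k_1=5$: 4,4,4,5,5,5,5,5,5,4,5,5; $k_1=6$: 4,4,5,5,5,5,6,6,5,4,5+,6; $k_1=7$: 3,4,4,4,5,5,6,6,3,3,6,6; $k_1=8$: 3,3,3,4,4,5,5,3,2,3,5,2; $k_1=9$: 3,3,3,3,4,4,4,3,3,3,5,3; $k_1=10$: 5,5,5,5,5,5,5+,6,5,5,5,5; $k_1=11$: 3,3,4,4,5,5,6,6,2,3,5,(none).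 *)

theory Defs
  imports "HOL-Probability.Probability"
begin

section \<open>Zero-sum games: maximin and minimax strategies\<close>

text \<open>
  A payoff \<open>f s t\<close> goes from the minimizer to the maximizer; \<open>S\<close> and \<open>T\<close> are the strategy sets.
  All payoffs used below are bounded, so the infima and suprema are genuine.
\<close>

definition maximin :: "'s set \<Rightarrow> 't set \<Rightarrow> ('s \<Rightarrow> 't \<Rightarrow> real) \<Rightarrow> 's \<Rightarrow> bool" where
  "maximin S T f s \<longleftrightarrow> s \<in> S \<and> (\<forall>s'\<in>S. (INF t\<in>T. f s' t) \<le> (INF t\<in>T. f s t))"

definition minimax :: "'s set \<Rightarrow> 't set \<Rightarrow> ('s \<Rightarrow> 't \<Rightarrow> real) \<Rightarrow> 't \<Rightarrow> bool" where
  "minimax S T f t \<longleftrightarrow> t \<in> T \<and> (\<forall>t'\<in>T. (SUP s\<in>S. f s t) \<le> (SUP s\<in>S. f s t'))"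

definition game_solution :: "'s set \<Rightarrow> 't set \<Rightarrow> ('s \<Rightarrow> 't \<Rightarrow> real) \<Rightarrow> 's \<Rightarrow> 't \<Rightarrow> bool" where
  "game_solution S T f s t \<longleftrightarrow> maximin S T f s \<and> minimax S T f t"

definition has_value :: "'s set \<Rightarrow> 't set \<Rightarrow> ('s \<Rightarrow> 't \<Rightarrow> real) \<Rightarrow> real \<Rightarrow> bool" where
  "has_value S T f v \<longleftrightarrow>
     (SUP s\<in>S. INF t\<in>T. f s t) = v \<and> (INF t\<in>T. SUP s\<in>S. f s t) = v"

section \<open>The cards\<close>

definition two_card :: "nat pmf" where
  "two_card = embed_pmf (\<lambda>i. if i \<le> 9 then (16 + 9 * of_bool (i = 0)) / 13\<^sup>2 else 0)"

definition third_card :: "nat pmf" where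
  "third_card = embed_pmf (\<lambda>k. if k \<le> 9 then (1 + 3 * of_bool (k = 0)) / 13 else 0)"

lemma pmf_two_card:
  "pmf two_card i = (if i \<le> 9 then (16 + 9 * of_bool (i = 0)) / 13\<^sup>2 else 0)"
proof -
  let ?f = "\<lambda>i::nat. if i \<le> 9 then (16 + 9 * of_bool (i = 0)) / 13\<^sup>2 else (0::real)"
  have "(\<integral>\<^sup>+ i. ennreal (?f i) \<partial>count_space UNIV) = (\<Sum>i\<in>{..9}. ennreal (?f i))"
    by (rule nn_integral_count_space') auto
  also have "\<dots> = ennreal (\<Sum>i\<in>{..9}. ?f i)"
    by (rule sum_ennreal) auto
  also have "\<dots> = 1"
    by (simp add: eval_nat_numeral)
  finally show ?thesis
    unfolding two_card_def by (subst pmf_embed_pmf) auto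
qed

lemma pmf_third_card:
  "pmf third_card k = (if k \<le> 9 then (1 + 3 * of_bool (k = 0)) / 13 else 0)"
proof -
  let ?f = "\<lambda>k::nat. if k \<le> 9 then (1 + 3 * of_bool (k = 0)) / 13 else (0::real)"
  have "(\<integral>\<^sup>+ i. ennreal (?f i) \<partial>count_space UNIV) = (\<Sum>i\<in>{..9}. ennreal (?f i))"
    by (rule nn_integral_count_space') auto
  also have "\<dots> = ennreal (\<Sum>i\<in>{..9}. ?f i)"
    by (rule sum_ennreal) auto
  also have "\<dots> = 1"
    by (simp add: eval_nat_numeral)
  finally show ?thesis
    unfolding third_card_def by (subst pmf_embed_pmf) auto
qed

text \<open>A deal \<open>((x1, x2, y), (x1', x2', y'))\<close>; the third cards are dealt whether or not they are used.\<close>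

type_synonym deal = "(nat \<times> nat \<times> nat) \<times> (nat \<times> nat \<times> nat)"

definition deal_pmf :: "deal pmf" where
  "deal_pmf = pair_pmf (pair_pmf two_card (pair_pmf two_card two_card))
                       (pair_pmf third_card (pair_pmf third_card third_card))"

section \<open>The rules\<close>

text \<open>A pure strategy of a Player is a Boolean: \<open>True\<close> (1) is to draw on 5, \<open>False\<close> (0) to stand on 5.\<close>

definition draws :: "bool \<Rightarrow> nat \<Rightarrow> bool" where
  "draws u x \<longleftrightarrow> x \<le> 4 + of_bool u"

definition observed :: "bool \<Rightarrow> nat \<Rightarrow> nat \<Rightarrow> nat" where
  "observed u x x' = (if draws u x then x' else if x \<le> 7 then 10 else 11)"

definition final_total :: "bool \<Rightarrow> nat \<Rightarrow> nat \<Rightarrow> nat" where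
  "final_total u x x' = (if draws u x then (x + x') mod 10 else x)"

type_synonym info = "nat \<times> nat \<times> nat"

definition info_sets :: "info set" where
  "info_sets = {(k1, k2, j). k1 \<le> 11 \<and> k2 \<le> 11 \<and> (k1, k2) \<noteq> (11, 11) \<and> j \<le> 7}"

fun info_of :: "bool \<times> bool \<Rightarrow> deal \<Rightarrow> info" where
  "info_of (u1, u2) ((x1, x2, y), (x1', x2', y')) = (observed u1 x1 x1', observed u2 x2 x2', y)"

text \<open>\<open>hand_gain u x x' b\<close> is the gain of one Player when Banker, who has no natural, finishes with \<open>b\<close>.\<close>

definition hand_gain :: "bool \<Rightarrow> nat \<Rightarrow> nat \<Rightarrow> nat \<Rightarrow> real" where
  "hand_gain u x x' b = (if x \<ge> 8 then 1 else sgn (real (final_total u x x') - real b))"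

text \<open>
  \<open>gain \<theta> u d c\<close> is \<open>\<theta> G1 + (1 - \<theta>) G2\<close> on the deal \<open>d\<close>, where \<open>c\<close> tells whether Banker draws.
  It does not depend on \<open>c\<close> when Banker meets no information set.
\<close>

fun gain :: "real \<Rightarrow> bool \<times> bool \<Rightarrow> deal \<Rightarrow> bool \<Rightarrow> real" where
  "gain \<theta> (u1, u2) ((x1, x2, y), (x1', x2', y')) c =
     (if y \<ge> 8 \<or> (x1 \<ge> 8 \<and> x2 \<ge> 8)
      then \<theta> * sgn (real x1 - real y) + (1 - \<theta>) * sgn (real x2 - real y)
      else let b = (if c then (y + y') mod 10 else y)
           in \<theta> * hand_gain u1 x1 x1' b + (1 - \<theta>) * hand_gain u2 x2 x2' b)"

section \<open>The matrix game and its behavioral form\<close>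

definition pure_payoff :: "real \<Rightarrow> bool \<times> bool \<Rightarrow> info set \<Rightarrow> real" where
  "pure_payoff \<theta> u T = measure_pmf.expectation deal_pmf (\<lambda>d. gain \<theta> u d (info_of u d \<in> T))"

definition mixed_payoff :: "real \<Rightarrow> (bool \<times> bool) pmf \<Rightarrow> info set pmf \<Rightarrow> real" where
  "mixed_payoff \<theta> p \<sigma> =
     measure_pmf.expectation (pair_pmf p \<sigma>) (\<lambda>(u, T). pure_payoff \<theta> u T)"

definition banker_mixed :: "info set pmf set" where
  "banker_mixed = {\<sigma>. set_pmf \<sigma> \<subseteq> Pow info_sets}"

definition correlated_cooperative_equilibrium ::
  "real \<Rightarrow> (bool \<times> bool) pmf \<Rightarrow> info set pmf \<Rightarrow> bool" where
  "correlated_cooperative_equilibrium \<theta> p \<sigma> \<longleftrightarrow>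
     game_solution UNIV banker_mixed (mixed_payoff \<theta>) p \<sigma>"

definition banker_behavioral :: "(info \<Rightarrow> real) set" where
  "banker_behavioral = info_sets \<rightarrow>\<^sub>E {0..1}"

definition behavior_of :: "info set pmf \<Rightarrow> info \<Rightarrow> real" where
  "behavior_of \<sigma> = (\<lambda>\<iota>\<in>info_sets. measure_pmf.prob \<sigma> {T. \<iota> \<in> T})"

definition behavioral_payoff :: "real \<Rightarrow> (bool \<times> bool) pmf \<Rightarrow> (info \<Rightarrow> real) \<Rightarrow> real" where
  "behavioral_payoff \<theta> p \<beta> =
     measure_pmf.expectation (pair_pmf p deal_pmf)
       (\<lambda>(u, d). \<beta> (info_of u d) * gain \<theta> u d True + (1 - \<beta> (info_of u d)) * gain \<theta> u d False)"

definition mixture :: "(bool \<times> bool) pmf \<Rightarrow> real \<times> real \<times> real \<times> real" where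
  "mixture p = (pmf p (False, False), pmf p (False, True), pmf p (True, False), pmf p (True, True))"

section \<open>The equilibrium\<close>

definition theta_poly :: "real \<Rightarrow> real" where
  "theta_poly \<theta> = 6896169 - 1190915420 * \<theta> + 3549548480 * \<theta>^2 - 2372477184 * \<theta>^3"

definition theta_star :: real where
  "theta_star = (THE \<theta>. 0.49 < \<theta> \<and> \<theta> < 0.5 \<and> theta_poly \<theta> = 0)"

definition D :: "real \<Rightarrow> real" where
  "D \<theta> = 901 - 443072 * \<theta> * (1 - \<theta>)"

definition eq_players :: "real \<Rightarrow> real \<times> real \<times> real \<times> real" where
  "eq_players \<theta> =
     (0,
      10 * (- 3171 - 17332 * \<theta> + 20640 * \<theta>^2) / (3 * D \<theta>),
      10 * (137 - 23948 * \<theta> + 20640 * \<theta>^2) / (3 * D \<theta>),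
      (33043 - 916416 * \<theta> * (1 - \<theta>)) / (3 * D \<theta>))"

text \<open>
  Row \<open>k1\<close>, column \<open>k2\<close>. The two entries \<open>5+\<close>, at \<open>(6, 10)\<close> and \<open>(10, 6)\<close>, are written as 5;
  the mixing on \<open>j = 6\<close> is added in \<open>eq_banker\<close>. There is no entry at \<open>(11, 11)\<close>.
\<close>

definition drawing_table :: "nat list list" where
  "drawing_table =
    [[3,3,3,4,4,4,4,3,3,3,5,3],
     [3,3,4,4,4,4,4,4,3,3,5,3],
     [3,4,4,4,4,4,5,4,3,3,5,4],
     [4,4,4,4,4,5,5,4,4,3,5,4],
     [4,4,4,4,5,5,5,5,4,4,5,5],
     [4,4,4,5,5,5,5,5,5,4,5,5],
     [4,4,5,5,5,5,6,6,5,4,5,6],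
     [3,4,4,4,5,5,6,6,3,3,6,6],
     [3,3,3,4,4,5,5,3,2,3,5,2],
     [3,3,3,3,4,4,4,3,3,3,5,3],
     [5,5,5,5,5,5,5,6,5,5,5,5],
     [3,3,4,4,5,5,6,6,2,3,5]]"

definition eq_banker :: "real \<Rightarrow> info \<Rightarrow> real" where
  "eq_banker \<theta> = (\<lambda>(k1, k2, j)\<in>info_sets.
     if (k1, k2, j) = (6, 10, 6)
     then (21311777 - 393439433 * \<theta> + 620812136 * \<theta>^2) / (208 * D \<theta>)
     else if (k1, k2, j) = (10, 6, 6)
     then (248684480 - 848184839 * \<theta> + 620812136 * \<theta>^2) / (208 * D \<theta>)
     else of_bool (j \<le> drawing_table ! k1 ! k2))"

definition eq_value :: "real \<Rightarrow> real" where
  "eq_value \<theta> =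
     - (80 * (2421541645 - 515181045616 * \<theta> * (1 - \<theta>))) / (13^9 * D \<theta>)"

end

theory Submission
  imports Defs
begin

text \<open>
  Why the theorem holds. In a round Banker meets at most one information set, so the payoff is affine
  in his drawing probabilities, with a separate coefficient at every information set, the incentive to
  draw there (\<open>round_payoff_affine\<close>). A mixed strategy therefore matters only through its behavior
  (\<open>mixed_payoff_eq\<close>, \<open>behavior_of_surj\<close>), and Banker's best reply to a mixture of the Players is
  found cell by cell from the sign of the expected incentive. Given Banker's total, the two hands are
  independent, so the incentive at \<open>(k1, k2, j)\<close> is built from two tables about a single hand
  (\<open>round_payoff_signals\<close>): the probability of a signal, and the excess of drawing over standing.
  Both are integers up to powers of 13.

  The claimed strategies form a saddle point. On the side of Banker, the expected incentive under the
  Players' mixture is, up to a positive factor, a cubic polynomial in \<open>x = 1 - 2\<theta>\<close>, and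
  \<open>0 \<le> x < 1/126\<close>. It increases with \<open>j\<close>, so its sign matters only at the threshold of the drawing
  table and just above (\<open>draw_index_sign\<close>). In nearly all cells the value at \<open>x = 0\<close> dominates the
  remaining terms, which is an integer computation (\<open>clear_thresholds\<close>). It vanishes identically in
  the two mixing cells. At \<open>(2, 5, 5)\<close> it is a multiple of \<open>theta_poly\<close>, which is what determines
  the critical parameter; only three further cells need the exact polynomial. On the side of the
  Players, the mixing probabilities of Banker make the pairs \<open>(0, 1)\<close>, \<open>(1, 0)\<close> and \<open>(1, 1)\<close> equally
  good and \<open>(0, 0)\<close> strictly worse (\<open>equalizing\<close>, \<open>eq_banker_payoffs\<close>).

  Uniqueness is complementary slackness. An optimal mixture of the Players avoids \<open>(0, 0)\<close> and makes
  Banker indifferent in the two mixing cells, which leaves one solution of a linear system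
  (\<open>optimal_players_unique\<close>). An optimal strategy of Banker agrees with the table wherever the
  incentive is nonzero and makes the three active pairs equally good, which determines the two mixing
  probabilities (\<open>optimal_banker_unique\<close>).
\<close>

section \<open>Saddle points\<close>

text \<open>
  A saddle point fixes the value, so a strategy is maximin (minimax) exactly when it guarantees that
  value. Finding all solutions of the game then splits into two separate questions, one for each side.
\<close>

lemma game_with_saddle_point:
  fixes f :: "'s \<Rightarrow> 't \<Rightarrow> real"
  assumes bounded_payoff: "\<forall>s\<in>S. \<forall>t\<in>T. \<bar>f s t\<bar> \<le> K"
    and s0: "s0 \<in> S" and t0: "t0 \<in> T"
    and saddle: "\<forall>s\<in>S. f s t0 \<le> v" "\<forall>t\<in>T. v \<le> f s0 t"
  shows maximin_iff: "maximin S T f s \<longleftrightarrow> s \<in> S \<and> (\<forall>t\<in>T. v \<le> f s t)"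
    and minimax_iff: "minimax S T f t \<longleftrightarrow> t \<in> T \<and> (\<forall>s\<in>S. f s t \<le> v)"
    and value_at_saddle_point: "has_value S T f v"
proof -
  note bounded = bounded_payoff[rule_format] and upper = saddle(1)[rule_format]
    and lower = saddle(2)[rule_format]
  have bddb: "bdd_below (f s ` T)" if "s \<in> S" for s
    using bounded[OF that] by (intro bdd_belowI2[of _ "- K"]) (auto simp: abs_le_iff minus_le_iff)
  have bdda: "bdd_above ((\<lambda>s. f s t) ` S)" if "t \<in> T" for t
    using bounded[OF _ that] by (intro bdd_aboveI2[of _ _ K]) (auto simp: abs_le_iff)
  have inf_le: "(INF t\<in>T. f s t) \<le> f s t" if "s \<in> S" "t \<in> T" for s t
    using that bddb by (auto intro: cINF_lower)
  have le_sup: "f s t \<le> (SUP s\<in>S. f s t)" if "s \<in> S" "t \<in> T" for s t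
    using that bdda by (auto intro: cSUP_upper)
  have inf_le_v: "(INF t\<in>T. f s t) \<le> v" if "s \<in> S" for s
    using inf_le[OF that t0] upper[OF that] by simp
  have v_le_sup: "v \<le> (SUP s\<in>S. f s t)" if "t \<in> T" for t
    using le_sup[OF s0 that] lower[OF that] by simp
  have inf_s0: "(INF t\<in>T. f s0 t) = v"
    using t0 lower by (intro antisym inf_le_v[OF s0] cINF_greatest) auto
  have sup_t0: "(SUP s\<in>S. f s t0) = v"
    using s0 upper by (intro antisym v_le_sup[OF t0] cSUP_least) auto
  have "maximin S T f s \<longleftrightarrow> s \<in> S \<and> v \<le> (INF t\<in>T. f s t)"
    unfolding maximin_def using inf_s0 inf_le_v s0 by fastforce
  also have "\<dots> \<longleftrightarrow> s \<in> S \<and> (\<forall>t\<in>T. v \<le> f s t)"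
    using inf_le t0 by (auto intro: order_trans intro!: cINF_greatest)
  finally show "maximin S T f s \<longleftrightarrow> s \<in> S \<and> (\<forall>t\<in>T. v \<le> f s t)" .
  have "minimax S T f t \<longleftrightarrow> t \<in> T \<and> (SUP s\<in>S. f s t) \<le> v"
    unfolding minimax_def using sup_t0 v_le_sup t0 by fastforce
  also have "\<dots> \<longleftrightarrow> t \<in> T \<and> (\<forall>s\<in>S. f s t \<le> v)"
    using le_sup s0 by (auto intro: order_trans intro!: cSUP_least)
  finally show "minimax S T f t \<longleftrightarrow> t \<in> T \<and> (\<forall>s\<in>S. f s t \<le> v)" .
  have "(SUP s\<in>S. INF t\<in>T. f s t) = v"
  proof (rule antisym)
    show "(SUP s\<in>S. INF t\<in>T. f s t) \<le> v"
      using s0 inf_le_v by (intro cSUP_least) auto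
    have "bdd_above ((\<lambda>s. INF t\<in>T. f s t) ` S)"
      using inf_le_v by (intro bdd_aboveI2) auto
    then show "v \<le> (SUP s\<in>S. INF t\<in>T. f s t)"
      using s0 inf_s0 by (metis cSUP_upper)
  qed
  moreover have "(INF t\<in>T. SUP s\<in>S. f s t) = v"
  proof (rule antisym)
    show "v \<le> (INF t\<in>T. SUP s\<in>S. f s t)"
      using t0 v_le_sup by (intro cINF_greatest) auto
    have "bdd_below ((\<lambda>t. SUP s\<in>S. f s t) ` T)"
      using v_le_sup by (intro bdd_belowI2) auto
    then show "(INF t\<in>T. SUP s\<in>S. f s t) \<le> v"
      using t0 sup_t0 by (metis cINF_lower)
  qed
  ultimately show "has_value S T f v"
    by (simp add: has_value_def)
qed

section \<open>One round against a behavioral strategy\<close>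

lemma finite_info_sets: "finite info_sets"
  by (rule finite_subset[of _ "{..11} \<times> {..11} \<times> {..7}"]) (auto simp: info_sets_def)

definition hand_pmf :: "(nat \<times> nat) pmf" where
  "hand_pmf = pair_pmf two_card third_card"

definition hands :: "(nat \<times> nat) set" where
  "hands = {..9} \<times> {..9}"

lemma finite_hands [simp]: "finite hands"
  by (simp add: hands_def)

lemma set_two_card: "set_pmf two_card = {..9}"
  by (auto simp: set_pmf_eq pmf_two_card)

lemma set_third_card: "set_pmf third_card = {..9}"
  by (auto simp: set_pmf_eq pmf_third_card)

lemma set_hand: "set_pmf hand_pmf = hands"
  by (auto simp: hand_pmf_def hands_def set_two_card set_third_card)

text \<open>
  The payoff when the Players use a pure pair, as a function of an arbitrary \<open>\<beta>\<close>: pure strategies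
  are the 0/1-valued \<open>\<beta>\<close>, behavioral strategies those with values in the unit interval.
\<close>

definition round_payoff :: "real \<Rightarrow> bool \<times> bool \<Rightarrow> (info \<Rightarrow> real) \<Rightarrow> real" where
  "round_payoff \<theta> u \<beta> = measure_pmf.expectation deal_pmf
     (\<lambda>d. \<beta> (info_of u d) * gain \<theta> u d True + (1 - \<beta> (info_of u d)) * gain \<theta> u d False)"

lemma pure_payoff_eq: "pure_payoff \<theta> u T = round_payoff \<theta> u (\<lambda>\<iota>. of_bool (\<iota> \<in> T))"
  unfolding pure_payoff_def round_payoff_def by (intro Bochner_Integration.integral_cong) auto

lemma set_deal: "set_pmf deal_pmf = ({..9} \<times> {..9} \<times> {..9}) \<times> ({..9} \<times> {..9} \<times> {..9})"
  by (simp add: deal_pmf_def set_two_card set_third_card)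

lemma behavioral_payoff_eq:
  "behavioral_payoff \<theta> p \<beta> = (\<Sum>u\<in>UNIV. pmf p u * round_payoff \<theta> u \<beta>)"
proof -
  have "behavioral_payoff \<theta> p \<beta> = (\<Sum>(u, d)\<in>UNIV \<times> set_pmf deal_pmf.
      (\<beta> (info_of u d) * gain \<theta> u d True + (1 - \<beta> (info_of u d)) * gain \<theta> u d False)
       * (pmf p u * pmf deal_pmf d))"
    unfolding behavioral_payoff_def
    by (subst integral_measure_pmf_real[of "UNIV \<times> set_pmf deal_pmf"])
       (auto simp: set_deal pmf_pair split_beta intro!: sum.cong)
  also have "\<dots> = (\<Sum>u\<in>UNIV. pmf p u * round_payoff \<theta> u \<beta>)"
    unfolding sum.cartesian_product[symmetric] round_payoff_def
    by (subst integral_measure_pmf_real[of "set_pmf deal_pmf"])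
       (auto simp: set_deal sum_distrib_left algebra_simps intro!: sum.cong)
  finally show ?thesis .
qed

text \<open>
  The deal regrouped as Banker's cards and the two Players' hands; given Banker's cards, the hands
  are independent, which is what makes the tables of a single hand sufficient below.
\<close>

lemma deal_expectation:
  "measure_pmf.expectation deal_pmf f =
     (\<Sum>y\<le>9. \<Sum>y'\<le>9. pmf two_card y * pmf third_card y' *
        (\<Sum>a\<in>hands. \<Sum>b\<in>hands. pmf hand_pmf a * pmf hand_pmf b *
           f ((fst a, fst b, y), (snd a, snd b, y'))))"
proof -
  have "measure_pmf.expectation deal_pmf f = (\<Sum>d\<in>set_pmf deal_pmf. f d * pmf deal_pmf d)"
    by (rule integral_measure_pmf_real) (auto simp: set_deal)
  also have "\<dots> = (\<Sum>(y, y', a, b)\<in>{..9} \<times> {..9} \<times> hands \<times> hands.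
      pmf two_card y * pmf third_card y' *
        (pmf hand_pmf a * pmf hand_pmf b * f ((fst a, fst b, y), (snd a, snd b, y'))))"
    by (rule sum.reindex_bij_witness[where
          i = "\<lambda>(y, y', (x1, x1'), (x2, x2')). ((x1, x2, y), (x1', x2', y'))" and
          j = "\<lambda>((x1, x2, y), (x1', x2', y')). (y, y', (x1, x1'), (x2, x2'))"])
       (auto simp: deal_pmf_def set_two_card set_third_card hands_def hand_pmf_def pmf_pair)
  finally show ?thesis
    by (simp add: sum.cartesian_product[symmetric] sum_distrib_left)
qed

lemma observed_le: "x' \<le> 9 \<Longrightarrow> observed u x x' \<le> 11"
  by (auto simp: observed_def)

definition signal_prob :: "bool \<Rightarrow> nat \<Rightarrow> real" where
  "signal_prob u k = (\<Sum>a | a \<in> hands \<and> observed u (fst a) (snd a) = k. pmf hand_pmf a)"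

definition signal_gain :: "bool \<Rightarrow> nat \<Rightarrow> nat \<Rightarrow> real" where
  "signal_gain u k b = (\<Sum>a | a \<in> hands \<and> observed u (fst a) (snd a) = k.
     pmf hand_pmf a * hand_gain u (fst a) (snd a) b)"

text \<open>
  The contribution of one Player's hands with signal \<open>k\<close> to what the Players gain when Banker,
  holding \<open>j\<close>, draws instead of standing.
\<close>

definition draw_excess :: "bool \<Rightarrow> nat \<Rightarrow> nat \<Rightarrow> real" where
  "draw_excess u k j =
     (\<Sum>y'\<le>9. pmf third_card y' * signal_gain u k ((j + y') mod 10)) - signal_gain u k j"

lemma sum_by_signals:
  fixes \<phi> :: "nat \<Rightarrow> nat \<Rightarrow> real"
  shows "(\<Sum>a\<in>hands. \<Sum>b\<in>hands.
      \<phi> (observed u1 (fst a) (snd a)) (observed u2 (fst b) (snd b)) * (A a * B b)) =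
   (\<Sum>k1\<le>11. \<Sum>k2\<le>11. \<phi> k1 k2 *
      ((\<Sum>a | a \<in> hands \<and> observed u1 (fst a) (snd a) = k1. A a) *
       (\<Sum>b | b \<in> hands \<and> observed u2 (fst b) (snd b) = k2. B b)))"
proof -
  have group: "(\<Sum>a\<in>hands. g a) = (\<Sum>k\<le>11. \<Sum>a | a \<in> hands \<and> observed u (fst a) (snd a) = k. g a)"
    for g :: "nat \<times> nat \<Rightarrow> real" and u
    by (rule sum.group[symmetric]) (auto simp: hands_def intro: observed_le)
  have inner: "(\<Sum>b\<in>hands. \<phi> k1 (observed u2 (fst b) (snd b)) * (c * B b)) =
      (\<Sum>k2\<le>11. \<phi> k1 k2 * (c * (\<Sum>b | b \<in> hands \<and> observed u2 (fst b) (snd b) = k2. B b)))"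
    for k1 c
    by (subst group[of _ u2]) (auto simp: sum_distrib_left intro!: sum.cong)
  have "(\<Sum>a\<in>hands. \<Sum>b\<in>hands.
      \<phi> (observed u1 (fst a) (snd a)) (observed u2 (fst b) (snd b)) * (A a * B b)) =
    (\<Sum>k1\<le>11. \<Sum>a | a \<in> hands \<and> observed u1 (fst a) (snd a) = k1. \<Sum>k2\<le>11. \<phi> k1 k2 *
       (A a * (\<Sum>b | b \<in> hands \<and> observed u2 (fst b) (snd b) = k2. B b)))"
    unfolding inner by (subst group[of _ u1]) (auto intro!: sum.cong)
  also have "\<dots> = (\<Sum>k1\<le>11. \<Sum>k2\<le>11. \<phi> k1 k2 *
      ((\<Sum>a | a \<in> hands \<and> observed u1 (fst a) (snd a) = k1. A a) *
       (\<Sum>b | b \<in> hands \<and> observed u2 (fst b) (snd b) = k2. B b)))"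
    by (subst sum.swap) (simp add: sum_product, simp add: sum_distrib_left)
  finally show ?thesis .
qed

definition natural_payoff :: real where
  "natural_payoff = (\<Sum>y\<in>{8, 9}. pmf two_card y *
     (\<Sum>a\<in>hands. pmf hand_pmf a * sgn (real (fst a) - real y)))"

lemma sum_third_card: "(\<Sum>y'\<le>9. pmf third_card y') = 1"
  by (rule sum_pmf_eq_1) (auto simp: set_third_card)

lemma sum_hands: "(\<Sum>a\<in>hands. pmf hand_pmf a) = 1"
  by (rule sum_pmf_eq_1) (auto simp: set_hand)

text \<open>
  The clause for two natural Players agrees with the general one when Banker has no natural: each
  natural beats his total \<open>y \<le> 7\<close>, and it counts as a win against every final total.
\<close>

lemma gain_without_natural:
  assumes "y \<le> 7"
  shows "gain \<theta> (u1, u2) ((x1, x2, y), (x1', x2', y')) c =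
    \<theta> * hand_gain u1 x1 x1' (if c then (y + y') mod 10 else y)
    + (1 - \<theta>) * hand_gain u2 x2 x2' (if c then (y + y') mod 10 else y)"
  using assms by (auto simp: Let_def hand_gain_def)

text \<open>
  Conditioning on the two signals separates the Players: what Player 1 wins depends on Player 2 only
  through the probability of the signal that Player 2 sends, and conversely.
\<close>

lemma round_payoff_signals:
  "round_payoff \<theta> (u1, u2) \<beta> = natural_payoff +
     (\<Sum>j\<le>7. pmf two_card j * (\<Sum>k1\<le>11. \<Sum>k2\<le>11.
        (\<theta> * (signal_gain u1 k1 j * signal_prob u2 k2)
          + (1 - \<theta>) * (signal_prob u1 k1 * signal_gain u2 k2 j))
        + \<beta> (k1, k2, j) * (\<theta> * (draw_excess u1 k1 j * signal_prob u2 k2)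
          + (1 - \<theta>) * (signal_prob u1 k1 * draw_excess u2 k2 j))))"
proof -
  define V where "V y y' a b =
     \<beta> (observed u1 (fst a) (snd a), observed u2 (fst b) (snd b), y)
        * gain \<theta> (u1, u2) ((fst a, fst b, y), (snd a, snd b, y')) True
      + (1 - \<beta> (observed u1 (fst a) (snd a), observed u2 (fst b) (snd b), y))
        * gain \<theta> (u1, u2) ((fst a, fst b, y), (snd a, snd b, y')) False" for y y' a b
  define W where "W y y' = (\<Sum>a\<in>hands. \<Sum>b\<in>hands. pmf hand_pmf a * pmf hand_pmf b * V y y' a b)"
    for y y'
  have expand: "round_payoff \<theta> (u1, u2) \<beta> =
      (\<Sum>y\<le>9. pmf two_card y * (\<Sum>y'\<le>9. pmf third_card y' * W y y'))"
    unfolding round_payoff_def deal_expectation W_def V_def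
    by (simp add: sum_distrib_left mult.assoc)
  \<comment> \<open>Against a natural of Banker both Players face the same lottery, hence \<open>\<theta>\<close> and the strategies drop out.\<close>
  have high: "W y y' = (\<Sum>a\<in>hands. pmf hand_pmf a * sgn (real (fst a) - real y))" if "8 \<le> y" for y y'
  proof -
    let ?S = "\<lambda>a :: nat \<times> nat. sgn (real (fst a) - real y)"
    have "W y y' = (\<Sum>a\<in>hands. \<Sum>b\<in>hands.
        \<theta> * (pmf hand_pmf b * (pmf hand_pmf a * ?S a))
        + (1 - \<theta>) * (pmf hand_pmf a * (pmf hand_pmf b * ?S b)))"
      unfolding W_def V_def using that by (intro sum.cong refl) (simp add: algebra_simps)
    also have "\<dots> = \<theta> * ((\<Sum>b\<in>hands. pmf hand_pmf b) * (\<Sum>a\<in>hands. pmf hand_pmf a * ?S a))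
        + (1 - \<theta>) * ((\<Sum>a\<in>hands. pmf hand_pmf a) * (\<Sum>b\<in>hands. pmf hand_pmf b * ?S b))"
      unfolding sum.distrib sum_product by (subst sum.swap) (simp add: sum_distrib_left)
    finally show ?thesis
      by (simp add: sum_hands algebra_simps)
  qed
  have low: "W y y' = (\<Sum>k1\<le>11. \<Sum>k2\<le>11.
      \<beta> (k1, k2, y) * (\<theta> * (signal_gain u1 k1 ((y + y') mod 10) * signal_prob u2 k2)
        + (1 - \<theta>) * (signal_prob u1 k1 * signal_gain u2 k2 ((y + y') mod 10)))
      + (1 - \<beta> (k1, k2, y)) * (\<theta> * (signal_gain u1 k1 y * signal_prob u2 k2)
        + (1 - \<theta>) * (signal_prob u1 k1 * signal_gain u2 k2 y)))" if "y \<le> 7" for y y'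
  proof -
    define b' where "b' = (y + y') mod 10"
    define o1 where "o1 a = observed u1 (fst a) (snd a)" for a
    define o2 where "o2 a = observed u2 (fst a) (snd a)" for a
    define g1 where "g1 a b = pmf hand_pmf a * hand_gain u1 (fst a) (snd a) b" for a b
    define g2 where "g2 a b = pmf hand_pmf a * hand_gain u2 (fst a) (snd a) b" for a b
    let ?q = "pmf hand_pmf"
    have "W y y' = (\<Sum>a\<in>hands. \<Sum>b\<in>hands.
        \<theta> * (\<beta> (o1 a, o2 b, y) * (g1 a b' * ?q b)) + (1 - \<theta>) * (\<beta> (o1 a, o2 b, y) * (?q a * g2 b b'))
        + (\<theta> * ((1 - \<beta> (o1 a, o2 b, y)) * (g1 a y * ?q b))
        + (1 - \<theta>) * ((1 - \<beta> (o1 a, o2 b, y)) * (?q a * g2 b y))))"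
      unfolding W_def V_def gain_without_natural[OF that]
      by (intro sum.cong refl) (simp add: g1_def g2_def o1_def o2_def b'_def algebra_simps)
    also have "\<dots> =
        \<theta> * (\<Sum>a\<in>hands. \<Sum>b\<in>hands. \<beta> (o1 a, o2 b, y) * (g1 a b' * ?q b))
        + (1 - \<theta>) * (\<Sum>a\<in>hands. \<Sum>b\<in>hands. \<beta> (o1 a, o2 b, y) * (?q a * g2 b b'))
        + (\<theta> * (\<Sum>a\<in>hands. \<Sum>b\<in>hands. (1 - \<beta> (o1 a, o2 b, y)) * (g1 a y * ?q b))
        + (1 - \<theta>) * (\<Sum>a\<in>hands. \<Sum>b\<in>hands. (1 - \<beta> (o1 a, o2 b, y)) * (?q a * g2 b y)))"
      by (simp only: sum.distrib sum_distrib_left)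
    also have "\<dots> = (\<Sum>k1\<le>11. \<Sum>k2\<le>11.
        \<theta> * (\<beta> (k1, k2, y) * (signal_gain u1 k1 b' * signal_prob u2 k2))
        + (1 - \<theta>) * (\<beta> (k1, k2, y) * (signal_prob u1 k1 * signal_gain u2 k2 b'))
        + (\<theta> * ((1 - \<beta> (k1, k2, y)) * (signal_gain u1 k1 y * signal_prob u2 k2))
        + (1 - \<theta>) * ((1 - \<beta> (k1, k2, y)) * (signal_prob u1 k1 * signal_gain u2 k2 y))))"
      unfolding o1_def o2_def g1_def g2_def
      unfolding sum_by_signals[where \<phi> = "\<lambda>k1 k2. \<beta> (k1, k2, y)"]
        sum_by_signals[where \<phi> = "\<lambda>k1 k2. 1 - \<beta> (k1, k2, y)"]
        signal_gain_def[symmetric] signal_prob_def[symmetric]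
      by (simp only: sum.distrib sum_distrib_left)
    finally show ?thesis
      unfolding b'_def by (simp add: algebra_simps)
  qed
  have averaged: "(\<Sum>y'\<le>9. pmf third_card y' * W y y') = (\<Sum>k1\<le>11. \<Sum>k2\<le>11.
        (\<theta> * (signal_gain u1 k1 y * signal_prob u2 k2)
          + (1 - \<theta>) * (signal_prob u1 k1 * signal_gain u2 k2 y))
        + \<beta> (k1, k2, y) * (\<theta> * (draw_excess u1 k1 y * signal_prob u2 k2)
          + (1 - \<theta>) * (signal_prob u1 k1 * draw_excess u2 k2 y)))" if "y \<le> 7" for y
  proof -
    let ?r = "pmf third_card"
    have "(\<Sum>y'\<le>9. ?r y' * W y y') = (\<Sum>k1\<le>11. \<Sum>k2\<le>11. \<Sum>y'\<le>9. ?r y' * (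
      \<beta> (k1, k2, y) * (\<theta> * (signal_gain u1 k1 ((y + y') mod 10) * signal_prob u2 k2)
        + (1 - \<theta>) * (signal_prob u1 k1 * signal_gain u2 k2 ((y + y') mod 10)))
      + (1 - \<beta> (k1, k2, y)) * (\<theta> * (signal_gain u1 k1 y * signal_prob u2 k2)
        + (1 - \<theta>) * (signal_prob u1 k1 * signal_gain u2 k2 y))))"
      unfolding low[OF that] sum_distrib_left
      by (subst sum.swap) (intro sum.cong refl sum.swap)
    also have "\<dots> = (\<Sum>k1\<le>11. \<Sum>k2\<le>11.
      \<beta> (k1, k2, y) * (\<theta> * ((\<Sum>y'\<le>9. ?r y' * signal_gain u1 k1 ((y + y') mod 10)) * signal_prob u2 k2)
        + (1 - \<theta>) * (signal_prob u1 k1 * (\<Sum>y'\<le>9. ?r y' * signal_gain u2 k2 ((y + y') mod 10))))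
      + (1 - \<beta> (k1, k2, y)) * (\<theta> * (signal_gain u1 k1 y * signal_prob u2 k2)
        + (1 - \<theta>) * (signal_prob u1 k1 * signal_gain u2 k2 y)) * (\<Sum>y'\<le>9. ?r y'))"
      unfolding sum_distrib_left sum_distrib_right sum.distrib[symmetric]
      by (intro sum.cong refl) (simp add: algebra_simps)
    also have "\<dots> = (\<Sum>k1\<le>11. \<Sum>k2\<le>11.
        (\<theta> * (signal_gain u1 k1 y * signal_prob u2 k2)
          + (1 - \<theta>) * (signal_prob u1 k1 * signal_gain u2 k2 y))
        + \<beta> (k1, k2, y) * (\<theta> * (draw_excess u1 k1 y * signal_prob u2 k2)
          + (1 - \<theta>) * (signal_prob u1 k1 * draw_excess u2 k2 y)))"
      unfolding draw_excess_def sum_third_card by (intro sum.cong refl) (simp add: algebra_simps)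
    finally show ?thesis .
  qed
  have split: "{..9::nat} = {..7} \<union> {8, 9}"
    by auto
  have "round_payoff \<theta> (u1, u2) \<beta> =
      (\<Sum>y\<le>7. pmf two_card y * (\<Sum>y'\<le>9. pmf third_card y' * W y y'))
      + (\<Sum>y\<in>{8, 9}. pmf two_card y * (\<Sum>y'\<le>9. pmf third_card y' * W y y'))"
    unfolding expand by (subst split, rule sum.union_disjoint) auto
  also have "(\<Sum>y\<in>{8, 9}. pmf two_card y * (\<Sum>y'\<le>9. pmf third_card y' * W y y')) = natural_payoff"
    unfolding natural_payoff_def
    by (intro sum.cong refl) (auto simp: high sum_distrib_right[symmetric] sum_third_card)
  finally show ?thesis
    by (simp add: averaged)
qed

definition stand_payoff :: "real \<Rightarrow> bool \<times> bool \<Rightarrow> real" where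
  "stand_payoff \<theta> u = round_payoff \<theta> u (\<lambda>_. 0)"

text \<open>
  The coefficient of \<open>\<beta> \<iota>\<close> in the payoff. Banker wants it negative, since payoffs go to the Players.
\<close>

fun incentive :: "real \<Rightarrow> bool \<times> bool \<Rightarrow> info \<Rightarrow> real" where
  "incentive \<theta> (u1, u2) (k1, k2, j) = pmf two_card j *
     (\<theta> * (draw_excess u1 k1 j * signal_prob u2 k2)
      + (1 - \<theta>) * (signal_prob u1 k1 * draw_excess u2 k2 j))"

text \<open>
  A Player with a natural wins whatever Banker does. This also permits summing over the pair of
  signals \<open>(11, 11)\<close>, which is not an information set.
\<close>

lemma draw_excess_natural: "draw_excess u 11 j = 0"
proof -
  have "signal_gain u 11 b = signal_prob u 11" for b
    unfolding signal_gain_def signal_prob_def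
    by (intro sum.cong refl) (auto simp: observed_def hands_def hand_gain_def split: if_splits)
  then show ?thesis
    by (simp add: draw_excess_def sum_distrib_right[symmetric] sum_third_card)
qed

lemma sum_info_sets:
  fixes g :: "info \<Rightarrow> real"
  assumes "\<And>j. g (11, 11, j) = 0"
  shows "(\<Sum>\<iota>\<in>info_sets. g \<iota>) = (\<Sum>j\<le>7. \<Sum>k1\<le>11. \<Sum>k2\<le>11. g (k1, k2, j))"
proof -
  have "(\<Sum>\<iota>\<in>info_sets. g \<iota>) = (\<Sum>(k1, k2, j)\<in>{..11} \<times> {..11} \<times> {..7}. g (k1, k2, j))"
    by (rule sum.mono_neutral_cong_left) (auto simp: info_sets_def assms)
  also have "\<dots> = (\<Sum>(j, k1, k2)\<in>{..7} \<times> {..11} \<times> {..11}. g (k1, k2, j))"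
    by (rule sum.reindex_bij_witness[where i = "\<lambda>(j, k1, k2). (k1, k2, j)"
          and j = "\<lambda>(k1, k2, j). (j, k1, k2)"]) auto
  finally show ?thesis
    by (simp add: sum.cartesian_product[symmetric])
qed

text \<open>
  At most one information set is met in a round, so the payoff is affine in \<open>\<beta>\<close>, with one separate
  term for each information set.
\<close>

lemma round_payoff_affine:
  "round_payoff \<theta> u \<beta> = stand_payoff \<theta> u + (\<Sum>\<iota>\<in>info_sets. \<beta> \<iota> * incentive \<theta> u \<iota>)"
proof (cases u)
  case (Pair u1 u2)
  show ?thesis
    unfolding Pair stand_payoff_def round_payoff_signals
    by (subst sum_info_sets)
       (simp_all add: draw_excess_natural sum.distrib sum_distrib_left distrib_left mult_ac)
qed

lemma banker_behavioral_bounds: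
  "\<beta> \<in> banker_behavioral \<Longrightarrow> \<iota> \<in> info_sets \<Longrightarrow> 0 \<le> \<beta> \<iota> \<and> \<beta> \<iota> \<le> 1"
  unfolding banker_behavioral_def by (drule (1) PiE_mem) simp

lemma behavioral_payoff_bounded:
  assumes "\<beta> \<in> banker_behavioral"
  shows "\<bar>behavioral_payoff \<theta> p \<beta>\<bar> \<le>
    (\<Sum>u\<in>UNIV. \<bar>stand_payoff \<theta> u\<bar> + (\<Sum>\<iota>\<in>info_sets. \<bar>incentive \<theta> u \<iota>\<bar>))"
proof -
  have "\<bar>pmf p u * round_payoff \<theta> u \<beta>\<bar> \<le>
      \<bar>stand_payoff \<theta> u\<bar> + (\<Sum>\<iota>\<in>info_sets. \<bar>incentive \<theta> u \<iota>\<bar>)" (is "_ \<le> ?K") for u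
  proof -
    have "\<bar>\<Sum>\<iota>\<in>info_sets. \<beta> \<iota> * incentive \<theta> u \<iota>\<bar> \<le> (\<Sum>\<iota>\<in>info_sets. \<bar>incentive \<theta> u \<iota>\<bar>)"
      using banker_behavioral_bounds[OF assms]
      by (intro order_trans[OF sum_abs] sum_mono) (auto simp: abs_mult intro!: mult_left_le_one_le)
    then have "\<bar>round_payoff \<theta> u \<beta>\<bar> \<le> ?K"
      unfolding round_payoff_affine by linarith
    moreover have "\<bar>pmf p u * round_payoff \<theta> u \<beta>\<bar> \<le> \<bar>round_payoff \<theta> u \<beta>\<bar>"
      by (auto simp: abs_mult pmf_le_1 intro!: mult_left_le_one_le)
    ultimately show ?thesis
      by linarith
  qed
  then show ?thesis
    unfolding behavioral_payoff_eq by (intro order_trans[OF sum_abs] sum_mono) auto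
qed

section \<open>Mixed strategies and behavioral strategies\<close>

lemma finite_support: "\<sigma> \<in> banker_mixed \<Longrightarrow> finite (set_pmf \<sigma>)"
  using finite_info_sets by (auto simp: banker_mixed_def intro: finite_subset)

text \<open>
  By affinity only the marginal drawing probabilities of a mixed strategy matter.
\<close>

lemma mixed_payoff_eq:
  assumes "\<sigma> \<in> banker_mixed"
  shows "mixed_payoff \<theta> p \<sigma> = behavioral_payoff \<theta> p (behavior_of \<sigma>)"
proof -
  let ?S = "set_pmf \<sigma>"
  note [simp] = finite_support[OF assms]
  have prob: "measure_pmf.prob \<sigma> {T. \<iota> \<in> T} = (\<Sum>T\<in>?S. pmf \<sigma> T * of_bool (\<iota> \<in> T))" for \<iota> :: info
  proof -
    have "measure_pmf.prob \<sigma> {T. \<iota> \<in> T} = measure_pmf.prob \<sigma> ({T. \<iota> \<in> T} \<inter> ?S)"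
      by (simp add: measure_Int_set_pmf)
    also have "\<dots> = (\<Sum>T\<in>{T. \<iota> \<in> T} \<inter> ?S. pmf \<sigma> T)"
      by (simp add: measure_measure_pmf_finite)
    also have "\<dots> = (\<Sum>T\<in>?S. pmf \<sigma> T * of_bool (\<iota> \<in> T))"
      by (rule sum.mono_neutral_cong_left) auto
    finally show ?thesis .
  qed
  have total: "(\<Sum>T\<in>?S. pmf \<sigma> T) = 1"
    by (rule sum_pmf_eq_1) auto
  have average: "(\<Sum>T\<in>?S. pmf \<sigma> T * pure_payoff \<theta> u T) = round_payoff \<theta> u (behavior_of \<sigma>)" for u
  proof -
    have "(\<Sum>T\<in>?S. pmf \<sigma> T * pure_payoff \<theta> u T) =
        (\<Sum>T\<in>?S. pmf \<sigma> T) * stand_payoff \<theta> u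
        + (\<Sum>T\<in>?S. \<Sum>\<iota>\<in>info_sets. pmf \<sigma> T * of_bool (\<iota> \<in> T) * incentive \<theta> u \<iota>)"
      unfolding pure_payoff_eq round_payoff_affine
      by (simp add: distrib_left sum.distrib sum_distrib_right sum_distrib_left mult.assoc)
    also have "\<dots> = round_payoff \<theta> u (behavior_of \<sigma>)"
      unfolding total round_payoff_affine behavior_of_def
      by (subst sum.swap) (simp only: mult_1 prob sum_distrib_right restrict_apply' cong: sum.cong)
    finally show ?thesis .
  qed
  have "mixed_payoff \<theta> p \<sigma> = (\<Sum>(u, T)\<in>UNIV \<times> ?S. pure_payoff \<theta> u T * (pmf p u * pmf \<sigma> T))"
    unfolding mixed_payoff_def
    by (subst integral_measure_pmf_real[of "UNIV \<times> ?S"]) (auto simp: pmf_pair intro!: sum.cong)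
  also have "\<dots> = (\<Sum>u\<in>UNIV. pmf p u * (\<Sum>T\<in>?S. pmf \<sigma> T * pure_payoff \<theta> u T))"
    unfolding sum.cartesian_product[symmetric]
    by (simp add: sum_distrib_left mult_ac)
  finally show ?thesis
    unfolding average behavioral_payoff_eq .
qed

lemma behavior_of_in: "behavior_of \<sigma> \<in> banker_behavioral"
  by (auto simp: behavior_of_def banker_behavioral_def)

text \<open>
  Deciding independently at every information set realizes any prescribed drawing probabilities.
\<close>

lemma behavior_of_surj:
  assumes "\<beta> \<in> banker_behavioral"
  obtains \<sigma> where "\<sigma> \<in> banker_mixed" "behavior_of \<sigma> = \<beta>"
proof
  define \<sigma> where "\<sigma> = map_pmf (\<lambda>f. {\<iota> \<in> info_sets. f \<iota>})
    (Pi_pmf info_sets False (\<lambda>\<iota>. bernoulli_pmf (\<beta> \<iota>)))"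
  show "\<sigma> \<in> banker_mixed"
    by (auto simp: banker_mixed_def \<sigma>_def)
  show "behavior_of \<sigma> = \<beta>"
  proof
    fix \<iota>
    show "behavior_of \<sigma> \<iota> = \<beta> \<iota>"
    proof (cases "\<iota> \<in> info_sets")
      case True
      have "behavior_of \<sigma> \<iota> =
          measure_pmf.prob (map_pmf (\<lambda>f. f \<iota>)
            (Pi_pmf info_sets False (\<lambda>\<iota>. bernoulli_pmf (\<beta> \<iota>)))) {True}"
        using True by (auto simp: behavior_of_def \<sigma>_def vimage_def intro!: arg_cong2[where f = measure])
      also have "\<dots> = \<beta> \<iota>"
        using True banker_behavioral_bounds[OF assms True] finite_info_sets
        by (simp add: Pi_pmf_component measure_pmf_single)
      finally show ?thesis .
    next
      case False
      then show ?thesis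
        using PiE_arb[OF assms[unfolded banker_behavioral_def] False] by (simp add: behavior_of_def)
    qed
  qed
qed

section \<open>Integer tables of the hands\<close>

text \<open>
  All probabilities are integers over a power of 13: two-card totals are counted in units of
  \<open>1/13\<^sup>2\<close> and third cards in units of \<open>1/13\<close>.
\<close>

definition two_weight :: "nat \<Rightarrow> int" where
  "two_weight x = (if x = 0 then 25 else 16)"

definition third_weight :: "nat \<Rightarrow> int" where
  "third_weight y = (if y = 0 then 4 else 1)"

definition signal_count :: "bool \<Rightarrow> nat \<Rightarrow> int" where
  "signal_count u k =
     (\<Sum>(x, x')\<in>{..9} \<times> {..9}. if observed u x x' = k then two_weight x * third_weight x' else 0)"

definition gain_count :: "bool \<Rightarrow> nat \<Rightarrow> nat \<Rightarrow> int" where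
  "gain_count u k b =
     (\<Sum>(x, x')\<in>{..9} \<times> {..9}. if observed u x x' = k
        then two_weight x * third_weight x' *
          (if 8 \<le> x then 1 else sgn (int (final_total u x x') - int b)) else 0)"

text \<open>
  The values of \<open>signal_count\<close>, \<open>gain_count\<close> and of the numerators of \<open>draw_excess\<close>. Each list
  is indexed by the signal \<open>k\<close>; in the last two tables, each row is indexed by Banker's total.
\<close>

definition signal_table :: "bool \<Rightarrow> int list" where
  "signal_table u = (if u
    then [420, 105, 105, 105, 105, 105, 105, 105, 105, 105, 416, 416]
    else [356, 89, 89, 89, 89, 89, 89, 89, 89, 89, 624, 416])"

definition gain_table :: "bool \<Rightarrow> int list list" where
  "gain_table u = (if u
    then
     [[320, 156, 28, -100, -228, -356, -420, -420, -420, -420],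
      [105, 80, 39, 7, -25, -57, -89, -105, -105, -105],
      [105, 105, 80, 39, 7, -25, -57, -89, -105, -105],
      [105, 105, 105, 80, 39, 7, -25, -57, -89, -105],
      [105, 105, 105, 105, 80, 39, 7, -25, -57, -89],
      [89, 73, 73, 73, 73, 48, 7, -25, -57, -89],
      [89, 57, 41, 41, 41, 41, 16, -25, -57, -89],
      [89, 57, 25, 9, 9, 9, 9, -16, -57, -89],
      [89, 57, 25, -7, -23, -23, -23, -23, -48, -89],
      [89, 57, 25, -7, -39, -55, -55, -55, -55, -80],
      [416, 416, 416, 416, 416, 416, 208, -208, -416, -416],
      [416, 416, 416, 416, 416, 416, 416, 416, 416, 416]]
    else
     [[256, 92, -36, -164, -292, -356, -356, -356, -356, -356],
      [89, 64, 23, -9, -41, -73, -89, -89, -89, -89],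
      [89, 89, 64, 23, -9, -41, -73, -89, -89, -89],
      [89, 89, 89, 64, 23, -9, -41, -73, -89, -89],
      [89, 89, 89, 89, 64, 23, -9, -41, -73, -89],
      [89, 89, 89, 89, 89, 64, 23, -9, -41, -73],
      [73, 57, 57, 57, 57, 57, 32, -9, -41, -73],
      [73, 41, 25, 25, 25, 25, 25, 0, -41, -73],
      [73, 41, 9, -7, -7, -7, -7, -7, -32, -73],
      [73, 41, 9, -23, -39, -39, -39, -39, -39, -64],
      [624, 624, 624, 624, 624, 416, 0, -416, -624, -624],
      [416, 416, 416, 416, 416, 416, 416, 416, 416, 416]])"

definition excess_table :: "bool \<Rightarrow> int list list" where
  "excess_table u = (if u
    then
     [[-5060, -3420, -2140, -860, 420, 1700, 2340, 2340],
      [-1305, -1055, -645, -325, -5, 315, 635, 795],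
      [-1095, -1095, -845, -435, -115, 205, 525, 845],
      [-885, -885, -885, -635, -225, 95, 415, 735],
      [-675, -675, -675, -675, -425, -15, 305, 625],
      [-625, -465, -465, -465, -465, -215, 195, 515],
      [-735, -415, -255, -255, -255, -255, -5, 405],
      [-845, -525, -205, -45, -45, -45, -45, 205],
      [-955, -635, -315, 5, 165, 165, 165, 165],
      [-1065, -745, -425, -105, 215, 375, 375, 375],
      [-2496, -2496, -2496, -2496, -2496, -2496, -416, 3744],
      [0, 0, 0, 0, 0, 0, 0, 0]]
    else
     [[-4484, -2844, -1564, -284, 996, 1636, 1636, 1636],
      [-1193, -943, -533, -213, 107, 427, 587, 587],
      [-1015, -1015, -765, -355, -35, 285, 605, 765],
      [-837, -837, -837, -587, -177, 143, 463, 783],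
      [-659, -659, -659, -659, -409, 1, 321, 641],
      [-481, -481, -481, -481, -481, -231, 179, 499],
      [-463, -303, -303, -303, -303, -303, -53, 357],
      [-605, -285, -125, -125, -125, -125, -125, 125],
      [-747, -427, -107, 53, 53, 53, 53, 53],
      [-889, -569, -249, 71, 231, 231, 231, 231],
      [-4368, -4368, -4368, -4368, -4368, -2288, 1872, 6032],
      [0, 0, 0, 0, 0, 0, 0, 0]])"

lemma signal_count_table:
  "\<forall>u\<in>{False, True}. \<forall>k\<in>set [0..<12]. signal_count u k = signal_table u ! k"
  by code_simp

lemma gain_count_table:
  "\<forall>u\<in>{False, True}. \<forall>k\<in>set [0..<12]. \<forall>b\<in>set [0..<10]. gain_count u k b = gain_table u ! k ! b"
  by code_simp

lemma excess_from_gain_table: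
  "\<forall>u\<in>{False, True}. \<forall>k\<in>set [0..<12]. \<forall>j\<in>set [0..<8].
     (\<Sum>y'\<in>{..9}. third_weight y' * gain_table u ! k ! ((j + y') mod 10))
       - 13 * gain_table u ! k ! j = excess_table u ! k ! j"
  by code_simp

lemma pmf_two_card_weight: "x \<le> 9 \<Longrightarrow> pmf two_card x = two_weight x / 169"
  by (simp add: pmf_two_card two_weight_def)

lemma pmf_third_card_weight: "x \<le> 9 \<Longrightarrow> pmf third_card x = third_weight x / 13"
  by (simp add: pmf_third_card third_weight_def)

lemma pmf_hand_weight:
  "a \<in> hands \<Longrightarrow> pmf hand_pmf a = real_of_int (two_weight (fst a) * third_weight (snd a)) / 2197"
  by (cases a) (simp add: hands_def hand_pmf_def pmf_pair pmf_two_card_weight pmf_third_card_weight)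

lemma sum_by_signal:
  fixes g :: "nat \<times> nat \<Rightarrow> real"
  shows "(\<Sum>a | a \<in> hands \<and> observed u (fst a) (snd a) = k. g a) =
    (\<Sum>(x, x')\<in>{..9} \<times> {..9}. if observed u x x' = k then g (x, x') else 0)"
  by (rule sum.mono_neutral_cong_left) (auto simp: hands_def split: if_splits)

lemma signal_prob_table:
  assumes "k \<le> 11"
  shows "signal_prob u k = signal_table u ! k / 2197"
proof -
  have "signal_prob u k = signal_count u k / 2197"
    unfolding signal_prob_def signal_count_def sum_by_signal of_int_sum sum_divide_distrib
    by (intro sum.cong) (auto simp: pmf_hand_weight hands_def)
  moreover have "signal_count u k = signal_table u ! k"
    using signal_count_table assms by (cases u) auto
  ultimately show ?thesis by simp
qed

lemma signal_gain_table:
  assumes "k \<le> 11" "b \<le> 9"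
  shows "signal_gain u k b = gain_table u ! k ! b / 2197"
proof -
  have sgn_diff: "sgn (real m - real n) = real_of_int (sgn (int m - int n))" for m n
    by (auto simp: sgn_if)
  have "signal_gain u k b = gain_count u k b / 2197"
    unfolding signal_gain_def gain_count_def sum_by_signal of_int_sum sum_divide_distrib
    by (intro sum.cong) (auto simp: pmf_hand_weight hands_def hand_gain_def sgn_diff)
  moreover have "gain_count u k b = gain_table u ! k ! b"
    using gain_count_table assms by (cases u) auto
  ultimately show ?thesis by simp
qed

lemma draw_excess_table:
  assumes "k \<le> 11" "j \<le> 7"
  shows "draw_excess u k j = excess_table u ! k ! j / 28561"
proof -
  let ?g = "\<lambda>b. gain_table u ! k ! b"
  have "draw_excess u k j =
      (\<Sum>y'\<le>9. third_weight y' / 13 * (?g ((j + y') mod 10) / 2197)) - ?g j / 2197"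
    unfolding draw_excess_def using assms
    by (simp add: signal_gain_table pmf_third_card_weight)
  also have "\<dots> = real_of_int ((\<Sum>y'\<le>9. third_weight y' * ?g ((j + y') mod 10)) - 13 * ?g j) / 28561"
    by (simp add: sum_divide_distrib diff_divide_distrib)
  also have "(\<Sum>y'\<le>9. third_weight y' * ?g ((j + y') mod 10)) - 13 * ?g j = excess_table u ! k ! j"
    using excess_from_gain_table assms by (cases u) auto
  finally show ?thesis .
qed

lemma natural_payoff_value: "natural_payoff = - 4384 / 13^4"
proof -
  have "(\<Sum>a\<in>hands. pmf hand_pmf a * sgn (real (fst a) - real y)) =
      (\<Sum>x\<le>9. pmf two_card x * sgn (real x - real y))" for y
    unfolding hands_def hand_pmf_def
    by (simp add: sum.cartesian_product' pmf_pair mult_ac flip: sum_distrib_right)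
       (simp add: sum_third_card)
  then have "natural_payoff = (\<Sum>y\<in>{8, 9}. pmf two_card y * (\<Sum>x\<le>9. pmf two_card x * sgn (real x - real y)))"
    by (simp add: natural_payoff_def)
  also have "\<dots> = - 4384 / 13^4"
    by (simp add: pmf_two_card atMost_nat_numeral)
  finally show ?thesis .
qed

text \<open>
  The higher Banker's total, the less he gains by drawing. Hence a negative incentive to draw
  persists at all lower totals and a positive one at all higher totals.
\<close>

lemma excess_rows_sorted: "\<forall>u\<in>{False, True}. \<forall>row\<in>set (excess_table u). sorted row \<and> length row = 8"
  by code_simp

lemma drawing_table_shape:
  "\<forall>k1\<in>set [0..<12]. \<forall>k2\<in>set [0..<11].
     drawing_table ! k1 ! k2 = drawing_table ! k2 ! k1 \<and> drawing_table ! k1 ! k2 \<le> 6"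
  by code_simp

text \<open>
  Only totals \<open>j \<le> m\<close> occur in the sum, so with \<open>m\<close> the table entry this collects the draws that
  the table prescribes against one pair of signals. Whole rows are passed as arguments in what
  follows, so that evaluation looks up each row once.
\<close>

definition draw_sum :: "int list \<Rightarrow> nat \<Rightarrow> int" where
  "draw_sum xs m = (\<Sum>j\<in>{..m}. two_weight j * xs ! j)"

definition row_total :: "int list \<Rightarrow> nat list \<Rightarrow> int list \<Rightarrow> int" where
  "row_total xs limits weights = (\<Sum>k\<in>{..11}. weights ! k * draw_sum xs (limits ! k))"

text \<open>
  The signal 11 of the first Player is left out: its row of \<open>excess_table\<close> vanishes, and the table
  has no entry at \<open>(11, 11)\<close>.
\<close>

definition draw_total :: "bool \<Rightarrow> bool \<Rightarrow> int" where
  "draw_total u1 u2 =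
     (\<Sum>k1\<in>{..10}. row_total (excess_table u1 ! k1) (drawing_table ! k1) (signal_table u2))"

definition stand_total :: "bool \<Rightarrow> int" where
  "stand_total u = (\<Sum>k\<in>{..11}. draw_sum (gain_table u ! k) 7)"

text \<open>
  In this form the payoffs of the drawing table are read off: against it, each Player obtains
  \<open>28561 * stand_total + draw_total\<close> in units of \<open>1/13\<^sup>9\<close>, apart from naturals of Banker.
\<close>

lemma totals:
  "draw_total False False = 1533225984 - 28561 * stand_total False"
  "draw_total False True = 1523210752 - 28561 * stand_total False"
  "draw_total True False = 1546346608 - 28561 * stand_total True"
  "draw_total True True = 1536376432 - 28561 * stand_total True"
  by code_simp+

section \<open>Signs of the incentives\<close>

text \<open>
  With \<open>x = 1 - 2\<theta>\<close> the weights of the Players are \<open>(1 - x)/2\<close> and \<open>(1 + x)/2\<close>, and on the interval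
  in question \<open>x\<close> is tiny. Sums and differences over the two Players are the coefficients of
  \<open>x\<^sup>0\<close> and \<open>- x\<^sup>1\<close> of the incentives, up to a common factor.
\<close>

definition pair_sum :: "bool \<Rightarrow> bool \<Rightarrow> nat \<Rightarrow> nat \<Rightarrow> nat \<Rightarrow> int" where
  "pair_sum u1 u2 k1 k2 j = excess_table u1 ! k1 ! j * signal_table u2 ! k2
     + signal_table u1 ! k1 * excess_table u2 ! k2 ! j"

definition pair_diff :: "bool \<Rightarrow> bool \<Rightarrow> nat \<Rightarrow> nat \<Rightarrow> nat \<Rightarrow> int" where
  "pair_diff u1 u2 k1 k2 j = excess_table u1 ! k1 ! j * signal_table u2 ! k2
     - signal_table u1 ! k1 * excess_table u2 ! k2 ! j"

definition pair_index :: "bool \<Rightarrow> bool \<Rightarrow> nat \<Rightarrow> nat \<Rightarrow> nat \<Rightarrow> real \<Rightarrow> real" where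
  "pair_index u1 u2 k1 k2 j x =
     real_of_int (pair_sum u1 u2 k1 k2 j) - real_of_int (pair_diff u1 u2 k1 k2 j) * x"

lemma incentive_table:
  assumes "k1 \<le> 11" "k2 \<le> 11" "j \<le> 7"
  shows "incentive \<theta> (u1, u2) (k1, k2, j) =
    two_weight j / (2 * 13^9) * pair_index u1 u2 k1 k2 j (1 - 2 * \<theta>)"
  using assms
  by (simp add: signal_prob_table draw_excess_table pmf_two_card_weight pair_index_def pair_sum_def
      pair_diff_def field_simps)

text \<open>
  The equilibrium probabilities of the Players multiplied by \<open>- 3 D \<theta>\<close> and written in terms of
  \<open>x = 1 - 2\<theta>\<close>. They are the solution of the two equations which say that Banker is indifferent at
  \<open>(6, 10, 6)\<close> and at \<open>(10, 6, 6)\<close>, with pure pair \<open>(0, 0)\<close> unused.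
\<close>

definition weight01 :: "real \<Rightarrow> real" where "weight01 x = 66770 + 16540 * x - 51600 * x^2"
definition weight10 :: "real \<Rightarrow> real" where "weight10 x = 66770 - 16540 * x - 51600 * x^2"
definition weight11 :: "real \<Rightarrow> real" where "weight11 x = 196061 - 229104 * x^2"

text \<open>
  A positive multiple of the expected incentive under the equilibrium mixture, so that Banker should
  draw where it is negative and stand where it is positive. It is a cubic polynomial in \<open>x\<close>.
\<close>

definition draw_index :: "nat \<Rightarrow> nat \<Rightarrow> nat \<Rightarrow> real \<Rightarrow> real" where
  "draw_index k1 k2 j x = weight01 x * pair_index False True k1 k2 j x
     + weight10 x * pair_index True False k1 k2 j x + weight11 x * pair_index True True k1 k2 j x"

lemma sum_pure_players:
  fixes g :: "bool \<times> bool \<Rightarrow> real"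
  shows "(\<Sum>u\<in>UNIV. g u) = g (False, False) + g (False, True) + g (True, False) + g (True, True)"
  by (simp add: UNIV_Times_UNIV[symmetric] sum.cartesian_product' UNIV_bool del: UNIV_Times_UNIV)

lemma eq_players_weights:
  "eq_players \<theta> = (0, - weight01 (1 - 2 * \<theta>) / (3 * D \<theta>), - weight10 (1 - 2 * \<theta>) / (3 * D \<theta>),
     - weight11 (1 - 2 * \<theta>) / (3 * D \<theta>))"
  by (simp add: eq_players_def weight01_def weight10_def weight11_def)
     (simp add: algebra_simps power2_eq_square)

lemma mean_incentive:
  assumes "mixture p = eq_players \<theta>" "k1 \<le> 11" "k2 \<le> 11" "j \<le> 7"
  shows "(\<Sum>u\<in>UNIV. pmf p u * incentive \<theta> u (k1, k2, j)) =
    two_weight j / (6 * 13^9 * - D \<theta>) * draw_index k1 k2 j (1 - 2 * \<theta>)"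
proof -
  have pmfs: "pmf p (False, False) = 0" "pmf p (False, True) = - weight01 (1 - 2 * \<theta>) / (3 * D \<theta>)"
    "pmf p (True, False) = - weight10 (1 - 2 * \<theta>) / (3 * D \<theta>)"
    "pmf p (True, True) = - weight11 (1 - 2 * \<theta>) / (3 * D \<theta>)"
    using assms(1) unfolding mixture_def eq_players_weights by auto
  show ?thesis
    unfolding sum_pure_players pmfs incentive_table[OF assms(2-4)] draw_index_def
    by (simp add: divide_simps) (simp add: algebra_simps)
qed

text \<open>
  The value of \<open>draw_index\<close> at \<open>x = 0\<close>, as a function of the three pair sums, followed by the sum
  of the absolute values of the coefficients of \<open>x\<close>, \<open>x\<^sup>2\<close> and \<open>x\<^sup>3\<close>.
\<close>

definition lead :: "int \<Rightarrow> int \<Rightarrow> int \<Rightarrow> int" where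
  "lead s01 s10 s11 = 66770 * (s01 + s10) + 196061 * s11"

definition remainder_bound :: "int \<Rightarrow> int \<Rightarrow> int \<Rightarrow> int \<Rightarrow> int \<Rightarrow> int \<Rightarrow> int" where
  "remainder_bound s01 s10 s11 d01 d10 d11 =
     \<bar>16540 * (s01 - s10) - 66770 * (d01 + d10) - 196061 * d11\<bar>
     + \<bar>16540 * (d01 - d10) + 51600 * (s01 + s10) + 229104 * s11\<bar>
     + \<bar>51600 * (d01 + d10) + 229104 * d11\<bar>"

text \<open>
  A sufficient condition for \<open>draw_index\<close> to have the sign \<open>\<epsilon>\<close> whenever \<open>0 \<le> x \<le> 1/126\<close>: the value
  at 0 dominates the rest. The constant 126 is chosen because \<open>1 - 2\<theta> < 0.007825 < 1/126\<close>
  for \<open>\<theta>\<close> above the critical parameter.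
\<close>

definition clear_cell ::
  "int list \<Rightarrow> int list \<Rightarrow> int \<Rightarrow> int \<Rightarrow> int list \<Rightarrow> int list \<Rightarrow> int \<Rightarrow> int \<Rightarrow> int \<Rightarrow> nat \<Rightarrow> bool" where
  "clear_cell e0 e1 m0 m1 e0' e1' m0' m1' \<epsilon> j =
    (let a01 = e0 ! j * m1'; b01 = m0 * e1' ! j;
         a10 = e1 ! j * m0'; b10 = m1 * e0' ! j;
         a11 = e1 ! j * m1'; b11 = m1 * e1' ! j
     in remainder_bound (a01 + b01) (a10 + b10) (a11 + b11) (a01 - b01) (a10 - b10) (a11 - b11)
          < 126 * (\<epsilon> * lead (a01 + b01) (a10 + b10) (a11 + b11)))"

definition clear_pair where
  "clear_pair e0 e1 m0 m1 e0' e1' m0' m1' m excused \<longleftrightarrow>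
     clear_cell e0 e1 m0 m1 e0' e1' m0' m1' (-1) m \<and>
     (excused \<or> clear_cell e0 e1 m0 m1 e0' e1' m0' m1' 1 (Suc m))"

text \<open>
  The pairs of signals for which the sign just above the threshold is not decided by the value at
  \<open>x = 0\<close>: the last two are those where Banker mixes, and for the first four the index at \<open>x = 0\<close>
  is small compared with its slope.
\<close>

definition delicate_pairs :: "(nat \<times> nat) list" where
  "delicate_pairs = [(2, 5), (5, 2), (3, 9), (9, 3), (6, 10), (10, 6)]"

definition clear_row where
  "clear_row k1 e0 e1 m0 m1 limits \<longleftrightarrow> (\<forall>k2\<in>set [0..<length limits].
     clear_pair e0 e1 m0 m1
       (excess_table False ! k2) (excess_table True ! k2) (signal_table False ! k2) (signal_table True ! k2)
       (limits ! k2) ((k1, k2) \<in> set delicate_pairs))"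

lemma clear_thresholds:
  "\<forall>k1\<in>set [0..<12]. clear_row k1 (excess_table False ! k1) (excess_table True ! k1)
     (signal_table False ! k1) (signal_table True ! k1) (drawing_table ! k1)"
  by code_simp

lemma draw_index_near_lead:
  assumes "0 \<le> x" "x \<le> 1 / 126"
  shows "126 * \<bar>draw_index k1 k2 j x - lead (pair_sum False True k1 k2 j)
      (pair_sum True False k1 k2 j) (pair_sum True True k1 k2 j)\<bar>
    \<le> remainder_bound (pair_sum False True k1 k2 j) (pair_sum True False k1 k2 j)
      (pair_sum True True k1 k2 j) (pair_diff False True k1 k2 j) (pair_diff True False k1 k2 j)
      (pair_diff True True k1 k2 j)"
proof -
  define s01 where "s01 = real_of_int (pair_sum False True k1 k2 j)"
  define s10 where "s10 = real_of_int (pair_sum True False k1 k2 j)"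
  define s11 where "s11 = real_of_int (pair_sum True True k1 k2 j)"
  define d01 where "d01 = real_of_int (pair_diff False True k1 k2 j)"
  define d10 where "d10 = real_of_int (pair_diff True False k1 k2 j)"
  define d11 where "d11 = real_of_int (pair_diff True True k1 k2 j)"
  define c1 where "c1 = 16540 * (s01 - s10) - 66770 * (d01 + d10) - 196061 * d11"
  define c2 where "c2 = 16540 * (d01 - d10) + 51600 * (s01 + s10) + 229104 * s11"
  define c3 where "c3 = 51600 * (d01 + d10) + 229104 * d11"
  have small: "126 * \<bar>c * x ^ Suc n\<bar> \<le> \<bar>c\<bar>" for c n
  proof -
    have "x ^ n \<le> 1"
      using assms by (intro power_le_one) auto
    then have "126 * x ^ Suc n \<le> 126 * (x * 1)"
      using assms by (simp add: mult_left_le)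
    also have "\<dots> \<le> 1"
      using assms by simp
    finally have "\<bar>c\<bar> * (126 * x ^ Suc n) \<le> \<bar>c\<bar> * 1"
      by (intro mult_left_mono) auto
    then show ?thesis
      using assms by (simp add: abs_mult algebra_simps)
  qed
  have triangle: "126 * \<bar>a - b + c\<bar> \<le> A + B + C"
    if "126 * \<bar>a\<bar> \<le> A" "126 * \<bar>b\<bar> \<le> B" "126 * \<bar>c\<bar> \<le> C" for a b c A B C :: real
    using that by (smt (verit))
  have "draw_index k1 k2 j x - (66770 * (s01 + s10) + 196061 * s11) = c1 * x ^ Suc 0 - c2 * x ^ Suc 1 + c3 * x ^ Suc 2"
    unfolding draw_index_def pair_index_def weight01_def weight10_def weight11_def c1_def c2_def c3_def
      s01_def[symmetric] s10_def[symmetric] s11_def[symmetric]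
      d01_def[symmetric] d10_def[symmetric] d11_def[symmetric]
    by (simp add: algebra_simps power2_eq_square power3_eq_cube)
  then have "126 * \<bar>draw_index k1 k2 j x - (66770 * (s01 + s10) + 196061 * s11)\<bar> \<le> \<bar>c1\<bar> + \<bar>c2\<bar> + \<bar>c3\<bar>"
    using triangle[OF small[of c1 0] small[of c2 1] small[of c3 2]] by simp
  then show ?thesis
    by (simp add: lead_def remainder_bound_def c1_def c2_def c3_def
        s01_def s10_def s11_def d01_def d10_def d11_def)
qed

lemma signal_table_nonneg:
  assumes "k \<le> 11"
  shows "0 \<le> signal_table u ! k"
proof -
  have "0 \<le> signal_prob u k"
    unfolding signal_prob_def by (intro sum_nonneg) auto
  then show ?thesis
    by (simp add: signal_prob_table assms)
qed

lemma excess_table_length: "length (excess_table u) = 12"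
  by (simp add: excess_table_def)

lemma excess_table_mono:
  assumes "k \<le> 11" "j \<le> j'" "j' \<le> 7"
  shows "excess_table u ! k ! j \<le> excess_table u ! k ! j'"
proof -
  have "excess_table u ! k \<in> set (excess_table u)"
    using assms by (simp add: excess_table_length)
  then have "sorted (excess_table u ! k)" "length (excess_table u ! k) = 8"
    using excess_rows_sorted by (cases u; auto)+
  then show ?thesis
    using assms by (intro sorted_nth_mono) auto
qed

lemma weights_positive:
  assumes "0 \<le> x" "x \<le> 1 / 126"
  shows "0 < weight01 x" "0 < weight10 x" "0 < weight11 x"
proof -
  have "x^2 \<le> 1^2"
    using assms by (intro power_mono) auto
  moreover have "x^2 \<le> x"
    using assms by (simp add: power2_eq_square mult_left_le)
  ultimately show "0 < weight01 x" "0 < weight10 x" "0 < weight11 x"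
    using assms unfolding weight01_def weight10_def weight11_def by linarith+
qed

text \<open>
  Both excesses in a pair are increasing in \<open>j\<close> and enter with the nonnegative factors \<open>1 - x\<close> and
  \<open>1 + x\<close>.
\<close>

lemma draw_index_mono:
  assumes "0 \<le> x" "x \<le> 1 / 126" "k1 \<le> 11" "k2 \<le> 11" "j \<le> j'" "j' \<le> 7"
  shows "draw_index k1 k2 j x \<le> draw_index k1 k2 j' x"
proof -
  have "pair_index u1 u2 k1 k2 j x \<le> pair_index u1 u2 k1 k2 j' x" for u1 u2
  proof -
    have split: "pair_index u1 u2 k1 k2 i x =
        (1 - x) * real_of_int (excess_table u1 ! k1 ! i * signal_table u2 ! k2)
        + (1 + x) * real_of_int (signal_table u1 ! k1 * excess_table u2 ! k2 ! i)" for i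
      by (simp add: pair_index_def pair_sum_def pair_diff_def algebra_simps)
    have "excess_table u1 ! k1 ! j * signal_table u2 ! k2 \<le> excess_table u1 ! k1 ! j' * signal_table u2 ! k2"
      "signal_table u1 ! k1 * excess_table u2 ! k2 ! j \<le> signal_table u1 ! k1 * excess_table u2 ! k2 ! j'"
      using assms by (auto intro!: mult_right_mono mult_left_mono excess_table_mono signal_table_nonneg)
    then show ?thesis
      unfolding split using assms by (intro add_mono mult_left_mono) (auto simp del: of_int_mult)
  qed
  then show ?thesis
    unfolding draw_index_def using weights_positive[OF assms(1,2)]
    by (intro add_mono mult_left_mono) auto
qed

lemma clear_cell_sign:
  assumes "0 \<le> x" "x \<le> 1 / 126" "\<bar>\<epsilon>\<bar> = 1"
    and "clear_cell (excess_table False ! k1) (excess_table True ! k1) (signal_table False ! k1)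
      (signal_table True ! k1) (excess_table False ! k2) (excess_table True ! k2)
      (signal_table False ! k2) (signal_table True ! k2) \<epsilon> j"
  shows "0 < \<epsilon> * draw_index k1 k2 j x"
proof -
  define L where "L = lead (pair_sum False True k1 k2 j) (pair_sum True False k1 k2 j) (pair_sum True True k1 k2 j)"
  define R where "R = remainder_bound (pair_sum False True k1 k2 j) (pair_sum True False k1 k2 j)
      (pair_sum True True k1 k2 j) (pair_diff False True k1 k2 j) (pair_diff True False k1 k2 j)
      (pair_diff True True k1 k2 j)"
  have "R < 126 * (\<epsilon> * L)"
    using assms(4) by (simp add: clear_cell_def Let_def L_def R_def pair_sum_def pair_diff_def)
  then have "real_of_int R < real_of_int (126 * (\<epsilon> * L))"
    by (simp only: of_int_less_iff)
  then have R: "real_of_int R < 126 * (\<epsilon> * real_of_int L)"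
    by simp
  have "126 * \<bar>draw_index k1 k2 j x - L\<bar> \<le> R"
    unfolding L_def R_def by (rule draw_index_near_lead[OF assms(1,2)])
  then have near: "126 * draw_index k1 k2 j x \<le> 126 * real_of_int L + real_of_int R"
    "126 * real_of_int L - real_of_int R \<le> 126 * draw_index k1 k2 j x"
    by (smt (verit))+
  from assms(3) have "\<epsilon> = 1 \<or> \<epsilon> = -1"
    by linarith
  then show ?thesis
    using R near by auto
qed

text \<open>
  The first of these cubics is \<open>50\<close> times \<open>theta_poly\<close> in the variable \<open>x\<close>: the critical parameter is
  where Banker is indifferent at \<open>(2, 5, 5)\<close>. Exchanging the Players amounts to \<open>x := - x\<close>.
\<close>

lemma draw_index_delicate:
  "draw_index 2 5 5 x = 113296550 - 14481879300 * x - 114591200 * x^2 + 14827982400 * x^3"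
  "draw_index 5 2 5 x = 113296550 + 14481879300 * x - 114591200 * x^2 - 14827982400 * x^3"
  "draw_index 9 3 4 x = 113296550 - 14472291000 * x - 114591200 * x^2 + 14815804800 * x^3"
  "draw_index 3 9 4 x = 113296550 + 14472291000 * x - 114591200 * x^2 - 14815804800 * x^3"
  by (simp_all add: draw_index_def pair_index_def pair_sum_def pair_diff_def weight01_def
      weight10_def weight11_def excess_table_def signal_table_def)
     (simp_all add: algebra_simps power2_eq_square power3_eq_cube)

lemma draw_index_mixed: "draw_index 6 10 6 x = 0" "draw_index 10 6 6 x = 0"
  by (simp_all add: draw_index_def pair_index_def pair_sum_def pair_diff_def weight01_def
      weight10_def weight11_def excess_table_def signal_table_def)
     (simp_all add: algebra_simps power2_eq_square power3_eq_cube)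

lemma clear_above_mixed:
  "\<forall>(k1, k2)\<in>{(6, 10), (10, 6)}. clear_cell
     (excess_table False ! k1) (excess_table True ! k1) (signal_table False ! k1) (signal_table True ! k1)
     (excess_table False ! k2) (excess_table True ! k2) (signal_table False ! k2) (signal_table True ! k2) 1 7"
  by code_simp

lemma draw_index_above_mixed:
  assumes "0 \<le> x" "x \<le> 1 / 126"
  shows "0 < draw_index 6 10 7 x" "0 < draw_index 10 6 7 x"
  using clear_above_mixed clear_cell_sign[OF assms, of 1 6 10 7] clear_cell_sign[OF assms, of 1 10 6 7]
  by auto

lemma draw_index_at_threshold:
  assumes "0 \<le> x" "x \<le> 1 / 126" "k1 \<le> 11" "k2 \<le> 11" "(k1, k2) \<noteq> (11, 11)"
  shows "draw_index k1 k2 (drawing_table ! k1 ! k2) x < 0"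
    and "(k1, k2) \<in> set delicate_pairs \<or> 0 < draw_index k1 k2 (Suc (drawing_table ! k1 ! k2)) x"
proof -
  have "\<forall>k1\<in>set [0..<12]. length (drawing_table ! k1) = (if k1 = 11 then 11 else 12)"
    by (auto simp: drawing_table_def less_Suc_eq numeral_eq_Suc)
  then have "k2 < length (drawing_table ! k1)"
    using assms by auto
  moreover have "clear_row k1 (excess_table False ! k1) (excess_table True ! k1)
     (signal_table False ! k1) (signal_table True ! k1) (drawing_table ! k1)"
    using clear_thresholds assms by auto
  ultimately have "clear_pair (excess_table False ! k1) (excess_table True ! k1) (signal_table False ! k1)
      (signal_table True ! k1) (excess_table False ! k2) (excess_table True ! k2)
      (signal_table False ! k2) (signal_table True ! k2) (drawing_table ! k1 ! k2)
      ((k1, k2) \<in> set delicate_pairs)"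
    unfolding clear_row_def by auto
  then show "draw_index k1 k2 (drawing_table ! k1 ! k2) x < 0"
    and "(k1, k2) \<in> set delicate_pairs \<or> 0 < draw_index k1 k2 (Suc (drawing_table ! k1 ! k2)) x"
    unfolding clear_pair_def
    using clear_cell_sign[OF assms(1,2), of "-1" k1 k2] clear_cell_sign[OF assms(1,2), of 1 k1 k2]
    by auto
qed

lemma drawing_table_symmetric:
  assumes "k1 \<le> 11" "k2 \<le> 11" "(k1, k2) \<noteq> (11, 11)"
  shows "drawing_table ! k1 ! k2 = drawing_table ! k2 ! k1" "drawing_table ! k1 ! k2 \<le> 6"
proof -
  have *: "drawing_table ! k1 ! k2 = drawing_table ! k2 ! k1 \<and> drawing_table ! k1 ! k2 \<le> 6"
    if "k1 \<le> 11" "k2 \<le> 10" for k1 k2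
    using drawing_table_shape[rule_format, of k1 k2] that by simp
  consider "k2 \<le> 10" | "k1 \<le> 10" "k2 = 11"
    using assms by force
  then have "drawing_table ! k1 ! k2 = drawing_table ! k2 ! k1 \<and> drawing_table ! k1 ! k2 \<le> 6"
  proof cases
    case 1
    with assms(1) show ?thesis by (rule *)
  next
    case 2
    with *[of k2 k1] show ?thesis by auto
  qed
  then show "drawing_table ! k1 ! k2 = drawing_table ! k2 ! k1" "drawing_table ! k1 ! k2 \<le> 6"
    by simp_all
qed

text \<open>
  By monotonicity in \<open>j\<close> it suffices to look at the threshold and one step above it, except where
  that step is a mixing cell and the sign is needed two steps above.
\<close>

lemma draw_index_sign:
  assumes x: "0 \<le> x" "x < 0.007825" and root: "0 < draw_index 2 5 5 x"
    and \<iota>: "(k1, k2, j) \<in> info_sets" "(k1, k2, j) \<noteq> (6, 10, 6)" "(k1, k2, j) \<noteq> (10, 6, 6)"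
  shows "if j \<le> drawing_table ! k1 ! k2 then draw_index k1 k2 j x < 0 else 0 < draw_index k1 k2 j x"
proof -
  let ?m = "drawing_table ! k1 ! k2"
  have x': "x \<le> 1 / 126"
    using x by simp
  have k: "k1 \<le> 11" "k2 \<le> 11" "(k1, k2) \<noteq> (11, 11)" "j \<le> 7"
    using \<iota>(1) by (auto simp: info_sets_def)
  note m = drawing_table_symmetric(2)[OF k(1-3)]
  note mono = draw_index_mono[OF x(1) x' k(1,2)]
  show ?thesis
  proof (cases "j \<le> ?m")
    case True
    then have "draw_index k1 k2 j x \<le> draw_index k1 k2 ?m x"
      using m by (intro mono) auto
    also have "\<dots> < 0"
      by (rule draw_index_at_threshold(1)[OF x(1) x' k(1-3)])
    finally show ?thesis
      using True by simp
  next
    case False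
    then have above: "draw_index k1 k2 (Suc ?m) x \<le> draw_index k1 k2 j x"
      using k(4) by (intro mono) auto
    have "0 < draw_index k1 k2 j x"
    proof (cases "(k1, k2) = (6, 10) \<or> (k1, k2) = (10, 6)")
      case True
      then have "?m = 5"
        by (auto simp: drawing_table_def)
      then have "j = 7"
        using False \<iota>(2,3) k(4) True by auto
      then show ?thesis
        using True draw_index_above_mixed[OF x(1) x'] by auto
    next
      case not_mixed: False
      \<comment> \<open>The cubic at \<open>(9, 3, 4)\<close> has a root only slightly above \<open>0.007825\<close>, hence the precise bounds.\<close>
      have "x^2 \<le> 0.007825^2" "x^3 \<le> 0.007825^3"
        using x by (intro power_mono; simp)+
      then have sq: "x^2 \<le> 613 / 10000000" and cb: "x^3 \<le> 1 / 1000000"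
        by (simp_all add: power_divide)
      have "x < 313 / 40000"
        using x by simp
      have "0 < draw_index 5 2 5 x" "0 < draw_index 9 3 4 x" "0 < draw_index 3 9 4 x"
        using x(1) \<open>x < 313 / 40000\<close> sq cb zero_le_power[OF x(1), of 3] unfolding draw_index_delicate by linarith+
      with root have "\<forall>(k1, k2)\<in>{(2, 5), (5, 2), (3, 9), (9, 3)}.
          0 < draw_index k1 k2 (Suc (drawing_table ! k1 ! k2)) x"
        by (simp add: drawing_table_def)
      then have "0 < draw_index k1 k2 (Suc ?m) x"
        using draw_index_at_threshold(2)[OF x(1) x' k(1-3)] not_mixed
        by (auto simp: delicate_pairs_def)
      then show ?thesis
        using above by simp
    qed
    then show ?thesis
      using False by simp
  qed
qed

section \<open>Payoffs against the equilibrium strategy of Banker\<close>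

text \<open>
  The deterministic part of Banker's strategy; it stands in the two cells where the equilibrium
  strategy mixes. The undefined table entry at \<open>(11, 11)\<close> is harmless, since the incentives there vanish.
\<close>

definition table_strategy :: "info \<Rightarrow> real" where
  "table_strategy = (\<lambda>(k1, k2, j). of_bool (j \<le> drawing_table ! k1 ! k2))"

lemma draw_sum_real:
  fixes c :: "nat \<Rightarrow> real"
  assumes "m \<le> 7"
  shows "(\<Sum>j\<le>7. pmf two_card j * (of_bool (j \<le> m) * c j)) = (\<Sum>j\<le>m. two_weight j / 169 * c j)"
proof -
  have "(\<Sum>j\<le>7. pmf two_card j * (of_bool (j \<le> m) * c j)) = (\<Sum>j\<le>m. pmf two_card j * c j)"
    using assms by (intro sum.mono_neutral_cong_right) auto
  also have "\<dots> = (\<Sum>j\<le>m. two_weight j / 169 * c j)"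
    using assms by (simp add: pmf_two_card_weight)
  finally show ?thesis .
qed

lemma sum_signal_prob: "(\<Sum>k\<le>11. signal_prob u k) = 1"
proof -
  have "(\<Sum>k\<le>11. signal_prob u k) = (\<Sum>a\<in>hands. pmf hand_pmf a)"
    unfolding signal_prob_def by (rule sum.group) (auto simp: hands_def intro: observed_le)
  then show ?thesis
    by (simp add: sum_hands)
qed

lemma stand_total_real:
  "(\<Sum>j\<le>7. \<Sum>k\<le>11. pmf two_card j * signal_gain u k j) = stand_total u / 13^5"
proof -
  have cell: "(\<Sum>j\<le>7. pmf two_card j * signal_gain u k j) = draw_sum (gain_table u ! k) 7 / 13^5"
    if "k \<le> 11" for k
    using that by (simp add: draw_sum_def pmf_two_card_weight signal_gain_table sum_divide_distrib)
  have "(\<Sum>j\<le>7. \<Sum>k\<le>11. pmf two_card j * signal_gain u k j) =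
      (\<Sum>k\<le>11. \<Sum>j\<le>7. pmf two_card j * signal_gain u k j)"
    by (rule sum.swap)
  also have "\<dots> = (\<Sum>k\<le>11. draw_sum (gain_table u ! k) 7 / 13^5)"
    by (intro sum.cong refl cell) simp
  finally show ?thesis
    by (simp add: stand_total_def sum_divide_distrib)
qed

text \<open>
  Stated for a function \<open>t\<close> rather than for the table itself, so that it also covers the transposed
  table, which is needed for the second Player.
\<close>

lemma draw_total_real:
  assumes "\<And>k l. k \<le> 11 \<Longrightarrow> l \<le> 11 \<Longrightarrow> (k, l) \<noteq> (11, 11) \<Longrightarrow> t k l = drawing_table ! k ! l"
  shows "(\<Sum>j\<le>7. \<Sum>k\<le>11. \<Sum>l\<le>11.
      pmf two_card j * (of_bool (j \<le> t k l) * (draw_excess u k j * signal_prob u' l))) =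
    draw_total u u' / 13^9"
proof -
  have cell: "(\<Sum>j\<le>7. pmf two_card j * (of_bool (j \<le> t k l) * (draw_excess u k j * signal_prob u' l))) =
      signal_table u' ! l * draw_sum (excess_table u ! k) (drawing_table ! k ! l) / 13^9"
    if "k \<le> 10" "l \<le> 11" for k l
  proof -
    have t: "t k l = drawing_table ! k ! l" "t k l \<le> 6"
      using assms[of k l] drawing_table_symmetric(2)[of k l] that by auto
    show ?thesis
      using t(2) that unfolding t(1)[symmetric]
      by (subst draw_sum_real)
         (auto simp: draw_sum_def draw_excess_table signal_prob_table sum_distrib_left sum_divide_distrib
           intro!: sum.cong)
  qed
  have "(\<Sum>j\<le>7. \<Sum>k\<le>11. \<Sum>l\<le>11.
      pmf two_card j * (of_bool (j \<le> t k l) * (draw_excess u k j * signal_prob u' l))) =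
    (\<Sum>k\<le>11. \<Sum>l\<le>11. \<Sum>j\<le>7.
      pmf two_card j * (of_bool (j \<le> t k l) * (draw_excess u k j * signal_prob u' l)))"
    by (subst sum.swap) (intro sum.cong refl sum.swap)
  also have "\<dots> = (\<Sum>k\<le>10. \<Sum>l\<le>11. \<Sum>j\<le>7.
      pmf two_card j * (of_bool (j \<le> t k l) * (draw_excess u k j * signal_prob u' l)))"
  proof (rule sum.mono_neutral_right)
    show "\<forall>k\<in>{..11} - {..10}. (\<Sum>l\<le>11. \<Sum>j\<le>7.
        pmf two_card j * (of_bool (j \<le> t k l) * (draw_excess u k j * signal_prob u' l))) = 0"
    proof
      fix k :: nat assume "k \<in> {..11} - {..10}"
      then have "k = 11" by auto
      then show "(\<Sum>l\<le>11. \<Sum>j\<le>7.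
          pmf two_card j * (of_bool (j \<le> t k l) * (draw_excess u k j * signal_prob u' l))) = 0"
        by (simp add: draw_excess_natural)
    qed
  qed auto
  also have "\<dots> = (\<Sum>k\<le>10. \<Sum>l\<le>11.
      signal_table u' ! l * draw_sum (excess_table u ! k) (drawing_table ! k ! l) / 13^9)"
    by (intro sum.cong refl cell) auto
  finally show ?thesis
    by (simp add: draw_total_def row_total_def sum_divide_distrib)
qed

lemma round_payoff_table_strategy:
  "round_payoff \<theta> (u1, u2) table_strategy = - 4384 / 13^4 +
     (\<theta> * (28561 * real_of_int (stand_total u1) + real_of_int (draw_total u1 u2))
       + (1 - \<theta>) * (28561 * real_of_int (stand_total u2) + real_of_int (draw_total u2 u1))) / 13^9"
proof -
  let ?q = "pmf two_card" and ?m1 = "signal_prob u1" and ?m2 = "signal_prob u2"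
    and ?t = "\<lambda>k1 k2. drawing_table ! k1 ! k2"
  have "round_payoff \<theta> (u1, u2) table_strategy = natural_payoff
      + \<theta> * (\<Sum>j\<le>7. \<Sum>k1\<le>11. \<Sum>k2\<le>11. ?q j * (signal_gain u1 k1 j * ?m2 k2))
      + (1 - \<theta>) * (\<Sum>j\<le>7. \<Sum>k1\<le>11. \<Sum>k2\<le>11. ?q j * (?m1 k1 * signal_gain u2 k2 j))
      + \<theta> * (\<Sum>j\<le>7. \<Sum>k1\<le>11. \<Sum>k2\<le>11.
          ?q j * (of_bool (j \<le> ?t k1 k2) * (draw_excess u1 k1 j * ?m2 k2)))
      + (1 - \<theta>) * (\<Sum>j\<le>7. \<Sum>k1\<le>11. \<Sum>k2\<le>11.
          ?q j * (of_bool (j \<le> ?t k1 k2) * (?m1 k1 * draw_excess u2 k2 j)))"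
    unfolding round_payoff_signals table_strategy_def add.assoc sum_distrib_left sum.distrib[symmetric]
    by (intro arg_cong2[of _ _ _ _ "(+)"] refl sum.cong) (simp add: algebra_simps)
  also have "(\<Sum>j\<le>7. \<Sum>k1\<le>11. \<Sum>k2\<le>11. ?q j * (signal_gain u1 k1 j * ?m2 k2)) =
      (\<Sum>j\<le>7. \<Sum>k1\<le>11. ?q j * signal_gain u1 k1 j) * (\<Sum>k2\<le>11. ?m2 k2)"
    unfolding sum_distrib_right by (simp add: sum_distrib_left mult.assoc)
  also have "(\<Sum>j\<le>7. \<Sum>k1\<le>11. \<Sum>k2\<le>11. ?q j * (?m1 k1 * signal_gain u2 k2 j)) =
      (\<Sum>j\<le>7. \<Sum>k2\<le>11. \<Sum>k1\<le>11. ?q j * (?m1 k1 * signal_gain u2 k2 j))"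
    by (rule sum.cong[OF refl], rule sum.swap)
  also have "\<dots> = (\<Sum>j\<le>7. \<Sum>k2\<le>11. ?q j * signal_gain u2 k2 j) * (\<Sum>k1\<le>11. ?m1 k1)"
    unfolding sum_distrib_right by (simp add: sum_distrib_left mult_ac)
  also have "(\<Sum>j\<le>7. \<Sum>k1\<le>11. \<Sum>k2\<le>11.
          ?q j * (of_bool (j \<le> ?t k1 k2) * (draw_excess u1 k1 j * ?m2 k2))) = draw_total u1 u2 / 13^9"
    by (rule draw_total_real) simp
  also have "(\<Sum>j\<le>7. \<Sum>k1\<le>11. \<Sum>k2\<le>11.
          ?q j * (of_bool (j \<le> ?t k1 k2) * (?m1 k1 * draw_excess u2 k2 j))) =
      (\<Sum>j\<le>7. \<Sum>k2\<le>11. \<Sum>k1\<le>11.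
          ?q j * (of_bool (j \<le> ?t k1 k2) * (?m1 k1 * draw_excess u2 k2 j)))"
    by (rule sum.cong[OF refl], rule sum.swap)
  also have "\<dots> = draw_total u2 u1 / 13^9"
    unfolding mult.commute[of "?m1 _"]
    by (rule draw_total_real) (metis drawing_table_symmetric(1) prod.inject)
  finally show ?thesis
    by (simp add: sum_signal_prob stand_total_real natural_payoff_value field_simps)
qed

lemma mixing_cells: "(6, 10, 6) \<in> info_sets" "(10, 6, 6) \<in> info_sets"
  by (auto simp: info_sets_def)

lemma round_payoff_eq_banker:
  "round_payoff \<theta> u (eq_banker \<theta>) = round_payoff \<theta> u table_strategy
     + eq_banker \<theta> (6, 10, 6) * incentive \<theta> u (6, 10, 6)
     + eq_banker \<theta> (10, 6, 6) * incentive \<theta> u (10, 6, 6)"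
proof -
  have "(\<Sum>\<iota>\<in>info_sets. (eq_banker \<theta> \<iota> - table_strategy \<iota>) * incentive \<theta> u \<iota>) =
      (\<Sum>\<iota>\<in>{(6, 10, 6), (10, 6, 6)}. (eq_banker \<theta> \<iota> - table_strategy \<iota>) * incentive \<theta> u \<iota>)"
    using mixing_cells finite_info_sets
    by (intro sum.mono_neutral_right) (auto simp: eq_banker_def table_strategy_def split: if_splits)
  also have "\<dots> = eq_banker \<theta> (6, 10, 6) * incentive \<theta> u (6, 10, 6)
      + eq_banker \<theta> (10, 6, 6) * incentive \<theta> u (10, 6, 6)"
    by (simp add: table_strategy_def drawing_table_def)
  finally show ?thesis
    by (simp add: round_payoff_affine left_diff_distrib sum_subtractf)
qed

lemma eq_banker_mixing:
  "eq_banker \<theta> (6, 10, 6) = (21311777 - 393439433 * \<theta> + 620812136 * \<theta>^2) / (208 * D \<theta>)"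
  "eq_banker \<theta> (10, 6, 6) = (248684480 - 848184839 * \<theta> + 620812136 * \<theta>^2) / (208 * D \<theta>)"
  using mixing_cells by (simp_all add: eq_banker_def)

lemma incentive_mixing:
  "incentive \<theta> u (6, 10, 6) = 16 / 13^9 * (case u of
      (False, False) \<Rightarrow> - 33072 * \<theta> + 166608 * (1 - \<theta>)
    | (False, True) \<Rightarrow> - 22048 * \<theta> - 37024 * (1 - \<theta>)
    | (True, False) \<Rightarrow> - 3120 * \<theta> + 196560 * (1 - \<theta>)
    | (True, True) \<Rightarrow> - 2080 * \<theta> - 43680 * (1 - \<theta>))"
  "incentive \<theta> u (10, 6, 6) = 16 / 13^9 * (case u of
      (False, False) \<Rightarrow> 166608 * \<theta> - 33072 * (1 - \<theta>)
    | (False, True) \<Rightarrow> 196560 * \<theta> - 3120 * (1 - \<theta>)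
    | (True, False) \<Rightarrow> - 37024 * \<theta> - 22048 * (1 - \<theta>)
    | (True, True) \<Rightarrow> - 43680 * \<theta> - 2080 * (1 - \<theta>))"
proof -
  have "\<forall>u. incentive \<theta> u (6, 10, 6) = 16 / 13^9 * (case u of
      (False, False) \<Rightarrow> - 33072 * \<theta> + 166608 * (1 - \<theta>)
    | (False, True) \<Rightarrow> - 22048 * \<theta> - 37024 * (1 - \<theta>)
    | (True, False) \<Rightarrow> - 3120 * \<theta> + 196560 * (1 - \<theta>)
    | (True, True) \<Rightarrow> - 2080 * \<theta> - 43680 * (1 - \<theta>)) \<and>
   incentive \<theta> u (10, 6, 6) = 16 / 13^9 * (case u of
      (False, False) \<Rightarrow> 166608 * \<theta> - 33072 * (1 - \<theta>)
    | (False, True) \<Rightarrow> 196560 * \<theta> - 3120 * (1 - \<theta>)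
    | (True, False) \<Rightarrow> - 37024 * \<theta> - 22048 * (1 - \<theta>)
    | (True, True) \<Rightarrow> - 43680 * \<theta> - 2080 * (1 - \<theta>))"
    unfolding split_paired_All
    by (simp add: all_bool_eq incentive_table pair_index_def pair_sum_def pair_diff_def
        excess_table_def signal_table_def two_weight_def del: incentive.simps)
  then show "incentive \<theta> u (6, 10, 6) = 16 / 13^9 * (case u of
      (False, False) \<Rightarrow> - 33072 * \<theta> + 166608 * (1 - \<theta>)
    | (False, True) \<Rightarrow> - 22048 * \<theta> - 37024 * (1 - \<theta>)
    | (True, False) \<Rightarrow> - 3120 * \<theta> + 196560 * (1 - \<theta>)
    | (True, True) \<Rightarrow> - 2080 * \<theta> - 43680 * (1 - \<theta>))"
   "incentive \<theta> u (10, 6, 6) = 16 / 13^9 * (case u of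
      (False, False) \<Rightarrow> 166608 * \<theta> - 33072 * (1 - \<theta>)
    | (False, True) \<Rightarrow> 196560 * \<theta> - 3120 * (1 - \<theta>)
    | (True, False) \<Rightarrow> - 37024 * \<theta> - 22048 * (1 - \<theta>)
    | (True, True) \<Rightarrow> - 43680 * \<theta> - 2080 * (1 - \<theta>))"
    by blast+
qed

text \<open>
  The two mixing probabilities solve the two equations that make the three pure pairs in the support
  of the Players' mixture equally good. The remaining pair \<open>(0, 0)\<close> misses the value by an explicit
  amount, whose sign is that of \<open>D \<theta>\<close> when \<open>\<theta>\<close> is near \<open>1/2\<close>.
\<close>

lemma equalizing:
  assumes "D \<theta> \<noteq> 0"
  shows "round_payoff \<theta> (False, True) (eq_banker \<theta>) = eq_value \<theta>"
    and "round_payoff \<theta> (True, False) (eq_banker \<theta>) = eq_value \<theta>"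
    and "round_payoff \<theta> (True, True) (eq_banker \<theta>) = eq_value \<theta>"
    and "round_payoff \<theta> (False, False) (eq_banker \<theta>) =
      eq_value \<theta> + (1273709051904 * (\<theta> * (1 - \<theta>)) - 250963049216) / (13^9 * D \<theta>)"
  using assms
  by (simp_all add: round_payoff_eq_banker round_payoff_table_strategy totals eq_banker_mixing
      incentive_mixing eq_value_def divide_simps del: incentive.simps)
     (simp_all add: D_def algebra_simps power2_eq_square)

section \<open>The critical parameter\<close>

lemma theta_poly_strict_mono:
  assumes "0.49 \<le> a" "a < b" "b \<le> 0.5"
  shows "theta_poly a < theta_poly b"
proof -
  let ?c = "3549548480 * (a + b) - 2372477184 * (a^2 + a * b + b^2) - 1190915420"
  have "a * a \<le> 0.5 * 0.5" "a * b \<le> 0.5 * 0.5" "b * b \<le> 0.5 * 0.5"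
    using assms by (intro mult_mono; simp)+
  then have "0 < ?c"
    using assms by (simp add: power2_eq_square)
  then have "0 < (b - a) * ?c"
    using assms by simp
  then show ?thesis
    by (simp add: theta_poly_def algebra_simps power2_eq_square power3_eq_cube)
qed

lemma theta_poly_mono: "0.49 \<le> a \<Longrightarrow> a \<le> b \<Longrightarrow> b \<le> 0.5 \<Longrightarrow> theta_poly a \<le> theta_poly b"
  using theta_poly_strict_mono[of a b] by (cases "a = b") auto

lemma theta_poly_bracket: "theta_poly 0.4960875 < 0" "0 < theta_poly 0.4960885"
  by (simp_all add: theta_poly_def power_divide)

lemma theta_poly_root: "\<exists>!\<theta>. 0.49 < \<theta> \<and> \<theta> < 0.5 \<and> theta_poly \<theta> = 0"
proof -
  have "\<exists>x\<ge>0.4960875. x \<le> 0.4960885 \<and> theta_poly x = 0"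
    by (rule IVT')
       (use theta_poly_bracket in \<open>auto simp: theta_poly_def intro!: continuous_intros\<close>)
  then obtain x where x: "0.4960875 \<le> x" "x \<le> 0.4960885" "theta_poly x = 0"
    by blast
  show ?thesis
  proof (rule ex1I)
    show "0.49 < x \<and> x < 0.5 \<and> theta_poly x = 0"
      using x by simp
    fix y assume y: "0.49 < y \<and> y < 0.5 \<and> theta_poly y = 0"
    show "y = x"
      using theta_poly_strict_mono[of x y] theta_poly_strict_mono[of y x] x y by fastforce
  qed
qed

lemma theta_star_root: "0.49 < theta_star" "theta_star < 0.5" "theta_poly theta_star = 0"
  using theI'[OF theta_poly_root] unfolding theta_star_def by auto

lemma theta_star_bounds: "0.4960875 < theta_star" "theta_star < 0.4960885"
proof -
  show "0.4960875 < theta_star"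
  proof (rule ccontr)
    assume "\<not> ?thesis"
    then have "theta_star \<le> 0.4960875"
      by (simp only: not_less)
    then have "theta_poly theta_star \<le> theta_poly 0.4960875"
      using theta_star_root(1) by (intro theta_poly_mono) auto
    then show False
      using theta_poly_bracket(1) theta_star_root(3) by simp
  qed
  show "theta_star < 0.4960885"
  proof (rule ccontr)
    assume "\<not> ?thesis"
    then have "0.4960885 \<le> theta_star"
      by (simp only: not_less)
    then have "theta_poly 0.4960885 \<le> theta_poly theta_star"
      using theta_star_root(2) by (intro theta_poly_mono) auto
    then show False
      using theta_poly_bracket(2) theta_star_root(3) by simp
  qed
qed

section \<open>Behavioral payoffs around an equilibrium\<close>

text \<open>
  The test for optimality: a deviation of Banker costs or gains information set by information set,
  according to the expected incentive there.
\<close>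

lemma behavioral_payoff_diff:
  "behavioral_payoff \<theta> p \<beta> = behavioral_payoff \<theta> p \<beta>0
     + (\<Sum>\<iota>\<in>info_sets. (\<beta> \<iota> - \<beta>0 \<iota>) * (\<Sum>u\<in>UNIV. pmf p u * incentive \<theta> u \<iota>))"
proof -
  have "(\<Sum>\<iota>\<in>info_sets. (\<beta> \<iota> - \<beta>0 \<iota>) * (\<Sum>u\<in>UNIV. pmf p u * incentive \<theta> u \<iota>)) =
      (\<Sum>u\<in>UNIV. pmf p u * (\<Sum>\<iota>\<in>info_sets. (\<beta> \<iota> - \<beta>0 \<iota>) * incentive \<theta> u \<iota>))"
    by (simp only: sum_distrib_left mult.left_commute, rule sum.swap)
  also have "\<dots> = (\<Sum>u\<in>UNIV. pmf p u * (round_payoff \<theta> u \<beta> - round_payoff \<theta> u \<beta>0))"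
    unfolding round_payoff_affine by (simp add: left_diff_distrib sum_subtractf)
  finally show ?thesis
    by (simp add: behavioral_payoff_eq right_diff_distrib sum_subtractf)
qed

lemma behavioral_payoff_upd:
  assumes "\<iota> \<in> info_sets"
  shows "behavioral_payoff \<theta> p (\<beta>(\<iota> := c)) = behavioral_payoff \<theta> p \<beta>
     + (c - \<beta> \<iota>) * (\<Sum>u\<in>UNIV. pmf p u * incentive \<theta> u \<iota>)"
proof -
  have "(\<Sum>\<kappa>\<in>info_sets. ((\<beta>(\<iota> := c)) \<kappa> - \<beta> \<kappa>) * (\<Sum>u\<in>UNIV. pmf p u * incentive \<theta> u \<kappa>)) =
      (\<Sum>\<kappa>\<in>{\<iota>}. ((\<beta>(\<iota> := c)) \<kappa> - \<beta> \<kappa>) * (\<Sum>u\<in>UNIV. pmf p u * incentive \<theta> u \<kappa>))"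
    using assms finite_info_sets by (intro sum.mono_neutral_right) auto
  then show ?thesis
    by (subst behavioral_payoff_diff[of _ _ _ \<beta>]) simp
qed

lemma behavioral_payoff_pure: "behavioral_payoff \<theta> (return_pmf u) \<beta> = round_payoff \<theta> u \<beta>"
proof -
  have "behavioral_payoff \<theta> (return_pmf u) \<beta> = (\<Sum>u'\<in>{u}. pmf (return_pmf u) u' * round_payoff \<theta> u' \<beta>)"
    unfolding behavioral_payoff_eq by (intro sum.mono_neutral_right) (auto simp: pmf_return)
  then show ?thesis by simp
qed

lemma sum_pmf_players:
  "pmf p (False, False) + pmf p (False, True) + pmf p (True, False) + pmf p (True, True) = 1"
  using sum_pmf_eq_1[of UNIV p] by (simp add: sum_pure_players)

lemma mixture_ex:
  assumes "0 \<le> a" "0 \<le> b" "0 \<le> c" "a + b + c = 1"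
  obtains p where "mixture p = (0, a, b, c)"
proof
  let ?xs = "[((False, True), a), ((True, False), b), ((True, True), c)]"
  have "pmf_of_list_wf ?xs"
    using assms by (auto simp: pmf_of_list_wf_def)
  then show "mixture (pmf_of_list ?xs) = (0, a, b, c)"
    by (simp add: mixture_def pmf_pmf_of_list)
qed

section \<open>The equilibrium\<close>

locale above_theta_star =
  fixes \<theta> :: real
  assumes theta: "theta_star < \<theta>" "\<theta> \<le> 1 / 2"
begin

lemma product_bounds: "12499 / 50000 \<le> \<theta> * (1 - \<theta>)" "\<theta> * (1 - \<theta>) \<le> 1 / 4"
proof -
  have eq: "\<theta> * (1 - \<theta>) = 1 / 4 - (1 / 2 - \<theta>)^2"
    by (simp add: power2_eq_square algebra_simps)
  have "(1 / 2 - \<theta>)^2 \<le> 0.004^2"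
    using theta theta_star_bounds by (intro power_mono) auto
  then show "12499 / 50000 \<le> \<theta> * (1 - \<theta>)"
    unfolding eq by (simp add: power_divide)
  show "\<theta> * (1 - \<theta>) \<le> 1 / 4"
    unfolding eq by simp
qed

lemma D_negative: "D \<theta> < 0"
  using product_bounds unfolding D_def mult.assoc by linarith

lemma x_bounds: "0 \<le> 1 - 2 * \<theta>" "1 - 2 * \<theta> < 0.007825" "1 - 2 * \<theta> \<le> 1 / 126"
  using theta theta_star_bounds by simp_all

lemma eq_players_positive:
  assumes "mixture p = eq_players \<theta>"
  shows "0 < pmf p (False, True)" "0 < pmf p (True, False)" "0 < pmf p (True, True)"
    "pmf p (False, False) = 0"
  using assms weights_positive[OF x_bounds(1,3)] D_negative
  unfolding mixture_def eq_players_weights by (auto simp: divide_less_0_iff)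

lemma eq_players_exists: obtains p where "mixture p = eq_players \<theta>"
proof -
  have "- weight01 (1 - 2 * \<theta>) - weight10 (1 - 2 * \<theta>) - weight11 (1 - 2 * \<theta>) = 3 * D \<theta>"
    by (simp add: weight01_def weight10_def weight11_def D_def power2_eq_square algebra_simps)
  then have sum: "- weight01 (1 - 2 * \<theta>) / (3 * D \<theta>) + - weight10 (1 - 2 * \<theta>) / (3 * D \<theta>)
      + - weight11 (1 - 2 * \<theta>) / (3 * D \<theta>) = 1"
    unfolding add_divide_distrib[symmetric] using D_negative by simp
  show thesis
    by (rule mixture_ex[OF _ _ _ sum])
       (use weights_positive[OF x_bounds(1,3)] D_negative that in
         \<open>auto simp: eq_players_weights divide_le_0_iff\<close>)
qed

lemma eq_banker_mixes:
  "0 < eq_banker \<theta> (6, 10, 6)" "eq_banker \<theta> (6, 10, 6) < 1"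
  "0 < eq_banker \<theta> (10, 6, 6)" "eq_banker \<theta> (10, 6, 6) < 1"
proof -
  have "\<theta>^2 = \<theta> - \<theta> * (1 - \<theta>)"
    by (simp add: power2_eq_square algebra_simps)
  then have "\<theta> - 1 / 4 \<le> \<theta>^2" "\<theta>^2 \<le> \<theta> - 12499 / 50000"
    using product_bounds by linarith+
  then show "0 < eq_banker \<theta> (6, 10, 6)" "eq_banker \<theta> (6, 10, 6) < 1"
    "0 < eq_banker \<theta> (10, 6, 6)" "eq_banker \<theta> (10, 6, 6) < 1"
    using D_negative theta theta_star_bounds product_bounds
    unfolding eq_banker_mixing
    by (auto simp: divide_simps D_def algebra_simps power2_eq_square)
qed

lemma eq_banker_in: "eq_banker \<theta> \<in> banker_behavioral"
  using eq_banker_mixes mixing_cells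
  by (auto simp: banker_behavioral_def eq_banker_def PiE_def split: if_splits)

lemma mean_incentive_sign:
  assumes p: "mixture p = eq_players \<theta>" and \<iota>: "\<iota> \<in> info_sets"
    and unmixed: "\<iota> \<noteq> (6, 10, 6)" "\<iota> \<noteq> (10, 6, 6)"
  shows "eq_banker \<theta> \<iota> = 1 \<and> (\<Sum>u\<in>UNIV. pmf p u * incentive \<theta> u \<iota>) < 0 \<or>
    eq_banker \<theta> \<iota> = 0 \<and> 0 < (\<Sum>u\<in>UNIV. pmf p u * incentive \<theta> u \<iota>)"
proof -
  obtain k1 k2 j where [simp]: "\<iota> = (k1, k2, j)"
    by (cases \<iota>)
  have k: "k1 \<le> 11" "k2 \<le> 11" "j \<le> 7"
    using \<iota> by (auto simp: info_sets_def)
  have "draw_index 2 5 5 (1 - 2 * \<theta>) = 50 * theta_poly \<theta>"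
    unfolding draw_index_delicate theta_poly_def
    by (simp add: power2_eq_square power3_eq_cube algebra_simps)
  moreover have "theta_poly theta_star < theta_poly \<theta>"
    using theta theta_star_root by (intro theta_poly_strict_mono) auto
  ultimately have "0 < draw_index 2 5 5 (1 - 2 * \<theta>)"
    using theta_star_root(3) by simp
  then have sign: "if j \<le> drawing_table ! k1 ! k2 then draw_index k1 k2 j (1 - 2 * \<theta>) < 0
      else 0 < draw_index k1 k2 j (1 - 2 * \<theta>)"
    using \<iota> unmixed by (intro draw_index_sign x_bounds) auto
  define c where "c = two_weight j / (6 * 13^9 * - D \<theta>)"
  have "0 < c"
    using D_negative by (simp add: c_def two_weight_def divide_pos_neg)
  moreover have "(\<Sum>u\<in>UNIV. pmf p u * incentive \<theta> u \<iota>) = c * draw_index k1 k2 j (1 - 2 * \<theta>)"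
    using mean_incentive[OF p k] by (simp add: c_def)
  moreover have "eq_banker \<theta> \<iota> = of_bool (j \<le> drawing_table ! k1 ! k2)"
    using \<iota> unmixed by (auto simp: eq_banker_def)
  ultimately show ?thesis
    using sign by (auto simp: mult_less_0_iff zero_less_mult_iff split: if_splits)
qed

lemma mean_incentive_mixed:
  assumes "mixture p = eq_players \<theta>"
  shows "(\<Sum>u\<in>UNIV. pmf p u * incentive \<theta> u (6, 10, 6)) = 0"
    "(\<Sum>u\<in>UNIV. pmf p u * incentive \<theta> u (10, 6, 6)) = 0"
  by (simp_all add: mean_incentive[OF assms] draw_index_mixed del: incentive.simps)

lemma eq_banker_payoffs:
  "round_payoff \<theta> (False, True) (eq_banker \<theta>) = eq_value \<theta>"
  "round_payoff \<theta> (True, False) (eq_banker \<theta>) = eq_value \<theta>"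
  "round_payoff \<theta> (True, True) (eq_banker \<theta>) = eq_value \<theta>"
  "round_payoff \<theta> (False, False) (eq_banker \<theta>) < eq_value \<theta>"
proof -
  have D: "D \<theta> \<noteq> 0"
    using D_negative by simp
  show "round_payoff \<theta> (False, True) (eq_banker \<theta>) = eq_value \<theta>"
    "round_payoff \<theta> (True, False) (eq_banker \<theta>) = eq_value \<theta>"
    "round_payoff \<theta> (True, True) (eq_banker \<theta>) = eq_value \<theta>"
    by (fact equalizing[OF D])+
  have "(1273709051904 * (\<theta> * (1 - \<theta>)) - 250963049216) / (13^9 * D \<theta>) < 0"
    using product_bounds D_negative by (intro divide_pos_neg) auto
  then show "round_payoff \<theta> (False, False) (eq_banker \<theta>) < eq_value \<theta>"
    unfolding equalizing(4)[OF D] by simp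
qed

lemma payoff_against_eq_banker:
  "behavioral_payoff \<theta> p (eq_banker \<theta>) = eq_value \<theta>
     - pmf p (False, False) * (eq_value \<theta> - round_payoff \<theta> (False, False) (eq_banker \<theta>))"
proof -
  have "behavioral_payoff \<theta> p (eq_banker \<theta>) =
      (pmf p (False, False) + pmf p (False, True) + pmf p (True, False) + pmf p (True, True)) * eq_value \<theta>
      - pmf p (False, False) * (eq_value \<theta> - round_payoff \<theta> (False, False) (eq_banker \<theta>))"
    unfolding behavioral_payoff_eq sum_pure_players eq_banker_payoffs(1-3)
    by (simp add: algebra_simps)
  then show ?thesis
    by (simp add: sum_pmf_players)
qed

text \<open>
  Against the equilibrium strategy of Banker every mixture obtains the value, up to the loss from
  playing \<open>(0, 0)\<close>.
\<close>

lemma eq_banker_upper: "behavioral_payoff \<theta> p (eq_banker \<theta>) \<le> eq_value \<theta>"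
  using eq_banker_payoffs(4) unfolding payoff_against_eq_banker by (simp add: mult_nonneg_nonneg)

lemma deviation_terms_nonneg:
  assumes p: "mixture p = eq_players \<theta>" and \<beta>: "\<beta> \<in> banker_behavioral" and \<iota>: "\<iota> \<in> info_sets"
  shows "0 \<le> (\<beta> \<iota> - eq_banker \<theta> \<iota>) * (\<Sum>u\<in>UNIV. pmf p u * incentive \<theta> u \<iota>)"
proof (cases "\<iota> = (6, 10, 6) \<or> \<iota> = (10, 6, 6)")
  case True
  then show ?thesis
    using mean_incentive_mixed[OF p] by auto
next
  case False
  then show ?thesis
    using mean_incentive_sign[OF p \<iota>] banker_behavioral_bounds[OF \<beta> \<iota>]
    by (auto intro: mult_nonneg_nonneg mult_nonpos_nonpos)
qed

lemma payoff_of_eq_players: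
  assumes p: "mixture p = eq_players \<theta>"
  shows "behavioral_payoff \<theta> p \<beta> = eq_value \<theta>
     + (\<Sum>\<iota>\<in>info_sets. (\<beta> \<iota> - eq_banker \<theta> \<iota>) * (\<Sum>u\<in>UNIV. pmf p u * incentive \<theta> u \<iota>))"
  using behavioral_payoff_diff[of \<theta> p \<beta> "eq_banker \<theta>"] payoff_against_eq_banker[of p]
    eq_players_positive(4)[OF p] by simp

lemma eq_players_lower:
  assumes "mixture p = eq_players \<theta>" "\<beta> \<in> banker_behavioral"
  shows "eq_value \<theta> \<le> behavioral_payoff \<theta> p \<beta>"
  unfolding payoff_of_eq_players[OF assms(1)]
  by (simp add: sum_nonneg deviation_terms_nonneg[OF assms])

text \<open>
  An optimal mixture must obtain the value against \<open>eq_banker\<close>, which excludes \<open>(0, 0)\<close>, and it must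
  leave Banker no profitable change at a cell where \<open>eq_banker\<close> mixes. The resulting two linear
  equations, together with the probabilities summing to 1, have determinant a multiple of \<open>D \<theta>\<close>.
\<close>

lemma optimal_players_unique:
  assumes optimal: "\<And>\<beta>. \<beta> \<in> banker_behavioral \<Longrightarrow> eq_value \<theta> \<le> behavioral_payoff \<theta> p \<beta>"
  shows "mixture p = eq_players \<theta>"
proof -
  have attained: "behavioral_payoff \<theta> p (eq_banker \<theta>) = eq_value \<theta>"
    using optimal[OF eq_banker_in] eq_banker_upper by (simp add: antisym)
  then have p00: "pmf p (False, False) = 0"
    using eq_banker_payoffs(4) unfolding payoff_against_eq_banker by simp
  have indifferent: "(\<Sum>u\<in>UNIV. pmf p u * incentive \<theta> u \<iota>) = 0"
    if \<iota>: "\<iota> \<in> info_sets" "0 < eq_banker \<theta> \<iota>" "eq_banker \<theta> \<iota> < 1" for \<iota>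
  proof -
    let ?S = "\<Sum>u\<in>UNIV. pmf p u * incentive \<theta> u \<iota>"
    \<comment> \<open>Only the cases \<open>c = 0\<close> and \<open>c = 1\<close> are used: they bound the incentive from both sides.\<close>
    have "0 \<le> (c - eq_banker \<theta> \<iota>) * ?S" if "0 \<le> c" "c \<le> 1" for c
    proof -
      have "(eq_banker \<theta>)(\<iota> := c) \<in> banker_behavioral"
        using eq_banker_in \<iota>(1) that
        by (auto simp: banker_behavioral_def PiE_def Pi_def extensional_def)
      from optimal[OF this] show ?thesis
        by (simp add: behavioral_payoff_upd[OF \<iota>(1)] attained)
    qed
    from this[of 0] this[of 1] \<iota>(2,3) show ?thesis
      by (auto simp: zero_le_mult_iff mult_le_0_iff)
  qed
  define a where "a = pmf p (False, True)"
  define b where "b = pmf p (True, False)"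
  define c where "c = pmf p (True, True)"
  have c: "c = 1 - a - b"
    using sum_pmf_players[of p] p00 by (simp add: a_def b_def c_def)
  have "a * (- 22048 * \<theta> - 37024 * (1 - \<theta>)) + b * (- 3120 * \<theta> + 196560 * (1 - \<theta>))
      + c * (- 2080 * \<theta> - 43680 * (1 - \<theta>)) = 0"
    using indifferent[OF mixing_cells(1) eq_banker_mixes(1,2)] p00
    unfolding sum_pure_players incentive_mixing a_def b_def c_def
    by (simp add: algebra_simps flip: add_divide_distrib diff_divide_distrib)
  moreover have "a * (196560 * \<theta> - 3120 * (1 - \<theta>)) + b * (- 37024 * \<theta> - 22048 * (1 - \<theta>))
      + c * (- 43680 * \<theta> - 2080 * (1 - \<theta>)) = 0"
    using indifferent[OF mixing_cells(2) eq_banker_mixes(3,4)] p00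
    unfolding sum_pure_players incentive_mixing a_def b_def c_def
    by (simp add: algebra_simps flip: add_divide_distrib diff_divide_distrib)
  ultimately have "a * (3 * D \<theta>) = - weight01 (1 - 2 * \<theta>)" "b * (3 * D \<theta>) = - weight10 (1 - 2 * \<theta>)"
    unfolding c D_def weight01_def weight10_def by algebra+
  then have a: "a = - weight01 (1 - 2 * \<theta>) / (3 * D \<theta>)" and b: "b = - weight10 (1 - 2 * \<theta>) / (3 * D \<theta>)"
    using D_negative by (simp_all add: field_simps)
  moreover have "c = - weight11 (1 - 2 * \<theta>) / (3 * D \<theta>)"
    unfolding c a b using D_negative
    by (simp add: divide_simps)
       (simp add: weight01_def weight10_def weight11_def D_def power2_eq_square algebra_simps)
  ultimately show ?thesis
    unfolding mixture_def eq_players_weights using p00 by (simp add: a_def b_def c_def)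
qed

text \<open>
  Where the expected incentive under the equilibrium mixture is nonzero, an optimal strategy of Banker
  has no choice. By complementary slackness it also has to hold the pure pairs in the support of that
  mixture to exactly the value, and two of these equations determine the two mixing probabilities.
\<close>

lemma optimal_banker_unique:
  assumes \<beta>: "\<beta> \<in> banker_behavioral" and optimal: "\<And>p. behavioral_payoff \<theta> p \<beta> \<le> eq_value \<theta>"
  shows "\<beta> = eq_banker \<theta>"
proof -
  obtain p where p: "mixture p = eq_players \<theta>"
    by (rule eq_players_exists)
  let ?S = "\<lambda>\<iota>. \<Sum>u\<in>UNIV. pmf p u * incentive \<theta> u \<iota>"
  have attained: "behavioral_payoff \<theta> p \<beta> = eq_value \<theta>"
    using optimal eq_players_lower[OF p \<beta>] by (simp add: antisym)
  then have "(\<Sum>\<iota>\<in>info_sets. (\<beta> \<iota> - eq_banker \<theta> \<iota>) * ?S \<iota>) = 0"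
    unfolding payoff_of_eq_players[OF p] by simp
  then have zero: "\<forall>\<iota>\<in>info_sets. (\<beta> \<iota> - eq_banker \<theta> \<iota>) * ?S \<iota> = 0"
    using deviation_terms_nonneg[OF p \<beta>] finite_info_sets by (simp add: sum_nonneg_eq_0_iff)
  have unmixed: "\<beta> \<iota> = eq_banker \<theta> \<iota>"
    if "\<iota> \<in> info_sets" "\<iota> \<noteq> (6, 10, 6)" "\<iota> \<noteq> (10, 6, 6)" for \<iota>
  proof -
    have "?S \<iota> \<noteq> 0"
      using mean_incentive_sign[OF p that] by (auto simp only: less_irrefl)
    moreover have "(\<beta> \<iota> - eq_banker \<theta> \<iota>) * ?S \<iota> = 0"
      using that(1) zero by blast
    ultimately show ?thesis
      by (simp only: mult_eq_0_iff) simp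
  qed
  have below: "round_payoff \<theta> u \<beta> \<le> eq_value \<theta>" for u
    using optimal[of "return_pmf u"] by (simp add: behavioral_payoff_pure)
  have "pmf p (False, True) * (eq_value \<theta> - round_payoff \<theta> (False, True) \<beta>)
      + pmf p (True, False) * (eq_value \<theta> - round_payoff \<theta> (True, False) \<beta>)
      + pmf p (True, True) * (eq_value \<theta> - round_payoff \<theta> (True, True) \<beta>)
      = (pmf p (False, False) + pmf p (False, True) + pmf p (True, False) + pmf p (True, True)) * eq_value \<theta>
        - behavioral_payoff \<theta> p \<beta>"
    unfolding behavioral_payoff_eq sum_pure_players using eq_players_positive(4)[OF p]
    by (simp add: algebra_simps)
  also have "\<dots> = 0"
    by (simp add: sum_pmf_players attained)
  finally have "pmf p (False, True) * (eq_value \<theta> - round_payoff \<theta> (False, True) \<beta>) = 0"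
    "pmf p (True, False) * (eq_value \<theta> - round_payoff \<theta> (True, False) \<beta>) = 0"
    using below by (smt (verit) mult_nonneg_nonneg pmf_nonneg)+
  then have active: "round_payoff \<theta> (False, True) \<beta> = eq_value \<theta>"
    "round_payoff \<theta> (True, False) \<beta> = eq_value \<theta>"
    using eq_players_positive[OF p] by auto
  define s where "s = \<beta> (6, 10, 6) - eq_banker \<theta> (6, 10, 6)"
  define t where "t = \<beta> (10, 6, 6) - eq_banker \<theta> (10, 6, 6)"
  have shift: "round_payoff \<theta> u \<beta> - round_payoff \<theta> u (eq_banker \<theta>) =
      s * incentive \<theta> u (6, 10, 6) + t * incentive \<theta> u (10, 6, 6)" for u
  proof -
    have "round_payoff \<theta> u \<beta> - round_payoff \<theta> u (eq_banker \<theta>) =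
        (\<Sum>\<iota>\<in>info_sets. (\<beta> \<iota> - eq_banker \<theta> \<iota>) * incentive \<theta> u \<iota>)"
      by (simp add: round_payoff_affine left_diff_distrib sum_subtractf)
    also have "\<dots> = (\<Sum>\<iota>\<in>{(6, 10, 6), (10, 6, 6)}. (\<beta> \<iota> - eq_banker \<theta> \<iota>) * incentive \<theta> u \<iota>)"
      using mixing_cells finite_info_sets unmixed by (intro sum.mono_neutral_right) auto
    finally show ?thesis
      by (simp add: s_def t_def del: incentive.simps)
  qed
  have "s * (- 22048 * \<theta> - 37024 * (1 - \<theta>)) + t * (196560 * \<theta> - 3120 * (1 - \<theta>)) = 0"
    "s * (- 3120 * \<theta> + 196560 * (1 - \<theta>)) + t * (- 37024 * \<theta> - 22048 * (1 - \<theta>)) = 0"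
    using shift[of "(False, True)"] shift[of "(True, False)"]
    unfolding active eq_banker_payoffs incentive_mixing
    by (simp_all add: algebra_simps flip: add_divide_distrib diff_divide_distrib)
  then have "s * (1429572352 - 39647821824 * (\<theta> * (1 - \<theta>))) = 0"
    "t * (1429572352 - 39647821824 * (\<theta> * (1 - \<theta>))) = 0"
    by algebra+
  then have "s = 0" "t = 0"
    using product_bounds by auto
  then have inside: "\<beta> \<iota> = eq_banker \<theta> \<iota>" if "\<iota> \<in> info_sets" for \<iota>
    using unmixed[OF that] by (auto simp: s_def t_def)
  show ?thesis
    using \<beta> eq_banker_in inside unfolding banker_behavioral_def by (rule PiE_ext)
qed

lemma behavioral_game:
  "game_solution UNIV banker_behavioral (behavioral_payoff \<theta>) p \<beta>
     \<longleftrightarrow> mixture p = eq_players \<theta> \<and> \<beta> = eq_banker \<theta>"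
  "has_value UNIV banker_behavioral (behavioral_payoff \<theta>) (eq_value \<theta>)"
proof -
  obtain p0 where p0: "mixture p0 = eq_players \<theta>"
    by (rule eq_players_exists)
  have bounded: "\<forall>p\<in>UNIV. \<forall>\<beta>\<in>banker_behavioral. \<bar>behavioral_payoff \<theta> p \<beta>\<bar> \<le>
      (\<Sum>u\<in>UNIV. \<bar>stand_payoff \<theta> u\<bar> + (\<Sum>\<iota>\<in>info_sets. \<bar>incentive \<theta> u \<iota>\<bar>))"
    by (simp add: behavioral_payoff_bounded)
  have "\<forall>p\<in>UNIV. behavioral_payoff \<theta> p (eq_banker \<theta>) \<le> eq_value \<theta>"
    "\<forall>\<beta>\<in>banker_behavioral. eq_value \<theta> \<le> behavioral_payoff \<theta> p0 \<beta>"
    using eq_banker_upper eq_players_lower[OF p0] by blast+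
  note saddle = game_with_saddle_point[OF bounded UNIV_I eq_banker_in this]
  show "has_value UNIV banker_behavioral (behavioral_payoff \<theta>) (eq_value \<theta>)"
    by (rule saddle(3))
  show "game_solution UNIV banker_behavioral (behavioral_payoff \<theta>) p \<beta>
     \<longleftrightarrow> mixture p = eq_players \<theta> \<and> \<beta> = eq_banker \<theta>"
    unfolding game_solution_def saddle(1,2)
    using optimal_players_unique eq_players_lower optimal_banker_unique eq_banker_upper eq_banker_in
    by blast
qed

text \<open>
  Everything is carried over from the behavioral game along \<open>behavior_of\<close>, which preserves payoffs
  and is onto.
\<close>

lemma matrix_game:
  "correlated_cooperative_equilibrium \<theta> p \<sigma> \<longleftrightarrow>
     \<sigma> \<in> banker_mixed \<and> mixture p = eq_players \<theta> \<and> behavior_of \<sigma> = eq_banker \<theta>" (is ?eq)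
  "has_value UNIV banker_mixed (mixed_payoff \<theta>) (eq_value \<theta>)" (is ?val)
  "\<exists>p \<sigma>. correlated_cooperative_equilibrium \<theta> p \<sigma>" (is ?ex)
proof -
  obtain p0 where p0: "mixture p0 = eq_players \<theta>"
    by (rule eq_players_exists)
  obtain \<sigma>0 where \<sigma>0: "\<sigma>0 \<in> banker_mixed" "behavior_of \<sigma>0 = eq_banker \<theta>"
    by (rule behavior_of_surj[OF eq_banker_in])
  have "\<forall>p\<in>UNIV. mixed_payoff \<theta> p \<sigma>0 \<le> eq_value \<theta>"
    by (simp add: mixed_payoff_eq \<sigma>0 eq_banker_upper)
  moreover have "\<forall>\<sigma>\<in>banker_mixed. eq_value \<theta> \<le> mixed_payoff \<theta> p0 \<sigma>"
    by (simp add: mixed_payoff_eq eq_players_lower[OF p0 behavior_of_in])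
  moreover have "\<forall>p\<in>UNIV. \<forall>\<sigma>\<in>banker_mixed. \<bar>mixed_payoff \<theta> p \<sigma>\<bar> \<le>
      (\<Sum>u\<in>UNIV. \<bar>stand_payoff \<theta> u\<bar> + (\<Sum>\<iota>\<in>info_sets. \<bar>incentive \<theta> u \<iota>\<bar>))"
    by (simp add: mixed_payoff_eq behavioral_payoff_bounded[OF behavior_of_in])
  ultimately have saddle: "maximin UNIV banker_mixed (mixed_payoff \<theta>) p \<longleftrightarrow>
      p \<in> UNIV \<and> (\<forall>\<sigma>\<in>banker_mixed. eq_value \<theta> \<le> mixed_payoff \<theta> p \<sigma>)"
    "minimax UNIV banker_mixed (mixed_payoff \<theta>) \<sigma> \<longleftrightarrow>
      \<sigma> \<in> banker_mixed \<and> (\<forall>p\<in>UNIV. mixed_payoff \<theta> p \<sigma> \<le> eq_value \<theta>)"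
    "has_value UNIV banker_mixed (mixed_payoff \<theta>) (eq_value \<theta>)" for p \<sigma>
    using game_with_saddle_point[where S = UNIV and f = "mixed_payoff \<theta>", OF _ UNIV_I \<sigma>0(1)] by blast+
  show ?val
    by (rule saddle(3))
  have players: "(\<forall>\<sigma>\<in>banker_mixed. eq_value \<theta> \<le> mixed_payoff \<theta> p \<sigma>) \<longleftrightarrow> mixture p = eq_players \<theta>" for p
  proof
    assume *: "\<forall>\<sigma>\<in>banker_mixed. eq_value \<theta> \<le> mixed_payoff \<theta> p \<sigma>"
    have "eq_value \<theta> \<le> behavioral_payoff \<theta> p \<beta>" if "\<beta> \<in> banker_behavioral" for \<beta>
      using behavior_of_surj[OF that] * mixed_payoff_eq by metis
    then show "mixture p = eq_players \<theta>"
      by (rule optimal_players_unique)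
  qed (simp add: mixed_payoff_eq eq_players_lower behavior_of_in)
  have banker: "(\<forall>p. mixed_payoff \<theta> p \<sigma> \<le> eq_value \<theta>) \<longleftrightarrow> behavior_of \<sigma> = eq_banker \<theta>"
    if "\<sigma> \<in> banker_mixed" for \<sigma>
    unfolding mixed_payoff_eq[OF that]
    using optimal_banker_unique[OF behavior_of_in] eq_banker_upper by metis
  have eq: "correlated_cooperative_equilibrium \<theta> p \<sigma> \<longleftrightarrow>
     \<sigma> \<in> banker_mixed \<and> mixture p = eq_players \<theta> \<and> behavior_of \<sigma> = eq_banker \<theta>" for p \<sigma>
    unfolding correlated_cooperative_equilibrium_def game_solution_def saddle(1,2)
    using players banker by auto
  then show ?eq .
  show ?ex
    using eq p0 \<sigma>0 by blast
qed

end

theorem mainTheorem3: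
  shows
    "(\<exists>!\<theta>. 0.49 < \<theta> \<and> \<theta> < 0.5 \<and> theta_poly \<theta> = 0) \<and>
     \<bar>theta_star - 0.496088\<bar> \<le> 0.0000005 \<and>
     (\<forall>\<theta>. theta_star < \<theta> \<and> \<theta> \<le> 1/2 \<longrightarrow>
        (\<exists>p \<sigma>. correlated_cooperative_equilibrium \<theta> p \<sigma>) \<and>
        (\<forall>p \<sigma>. correlated_cooperative_equilibrium \<theta> p \<sigma>
           \<longleftrightarrow> \<sigma> \<in> banker_mixed \<and> mixture p = eq_players \<theta> \<and> behavior_of \<sigma> = eq_banker \<theta>) \<and>
        (\<forall>p \<beta>. game_solution UNIV banker_behavioral (behavioral_payoff \<theta>) p \<beta>
           \<longleftrightarrow> mixture p = eq_players \<theta> \<and> \<beta> = eq_banker \<theta>) \<and>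
        0 < eq_banker \<theta> (6, 10, 6) \<and> eq_banker \<theta> (6, 10, 6) < 1 \<and>
        0 < eq_banker \<theta> (10, 6, 6) \<and> eq_banker \<theta> (10, 6, 6) < 1 \<and>
        has_value UNIV banker_mixed (mixed_payoff \<theta>) (eq_value \<theta>) \<and>
        has_value UNIV banker_behavioral (behavioral_payoff \<theta>) (eq_value \<theta>)) \<and>
     eq_players (1/2) = (0, 110/543, 110/543, 323/543) \<and>
     eq_banker (1/2) (6, 10, 6) = 5121/5792 \<and>
     eq_banker (1/2) (10, 6, 6) = 5121/5792 \<and>
     eq_value (1/2) = - 16655514960 / (181 * 13^9)"
proof (intro conjI)
  show "\<exists>!\<theta>. 0.49 < \<theta> \<and> \<theta> < 0.5 \<and> theta_poly \<theta> = 0"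
    by (rule theta_poly_root)
  show "\<bar>theta_star - 0.496088\<bar> \<le> 0.0000005"
    using theta_star_bounds by (auto simp: abs_if)
  show "\<forall>\<theta>. theta_star < \<theta> \<and> \<theta> \<le> 1/2 \<longrightarrow>
        (\<exists>p \<sigma>. correlated_cooperative_equilibrium \<theta> p \<sigma>) \<and>
        (\<forall>p \<sigma>. correlated_cooperative_equilibrium \<theta> p \<sigma>
           \<longleftrightarrow> \<sigma> \<in> banker_mixed \<and> mixture p = eq_players \<theta> \<and> behavior_of \<sigma> = eq_banker \<theta>) \<and>
        (\<forall>p \<beta>. game_solution UNIV banker_behavioral (behavioral_payoff \<theta>) p \<beta>
           \<longleftrightarrow> mixture p = eq_players \<theta> \<and> \<beta> = eq_banker \<theta>) \<and>
        0 < eq_banker \<theta> (6, 10, 6) \<and> eq_banker \<theta> (6, 10, 6) < 1 \<and>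
        0 < eq_banker \<theta> (10, 6, 6) \<and> eq_banker \<theta> (10, 6, 6) < 1 \<and>
        has_value UNIV banker_mixed (mixed_payoff \<theta>) (eq_value \<theta>) \<and>
        has_value UNIV banker_behavioral (behavioral_payoff \<theta>) (eq_value \<theta>)"
  proof (intro allI impI)
    fix \<theta> :: real
    assume "theta_star < \<theta> \<and> \<theta> \<le> 1/2"
    then interpret above_theta_star \<theta>
      by unfold_locales auto
    show "(\<exists>p \<sigma>. correlated_cooperative_equilibrium \<theta> p \<sigma>) \<and>
        (\<forall>p \<sigma>. correlated_cooperative_equilibrium \<theta> p \<sigma>
           \<longleftrightarrow> \<sigma> \<in> banker_mixed \<and> mixture p = eq_players \<theta> \<and> behavior_of \<sigma> = eq_banker \<theta>) \<and>
        (\<forall>p \<beta>. game_solution UNIV banker_behavioral (behavioral_payoff \<theta>) p \<beta>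
           \<longleftrightarrow> mixture p = eq_players \<theta> \<and> \<beta> = eq_banker \<theta>) \<and>
        0 < eq_banker \<theta> (6, 10, 6) \<and> eq_banker \<theta> (6, 10, 6) < 1 \<and>
        0 < eq_banker \<theta> (10, 6, 6) \<and> eq_banker \<theta> (10, 6, 6) < 1 \<and>
        has_value UNIV banker_mixed (mixed_payoff \<theta>) (eq_value \<theta>) \<and>
        has_value UNIV banker_behavioral (behavioral_payoff \<theta>) (eq_value \<theta>)"
      using matrix_game behavioral_game eq_banker_mixes by simp
  qed
  show "eq_players (1/2) = (0, 110/543, 110/543, 323/543)"
    by (simp add: eq_players_def D_def power2_eq_square)
  show "eq_banker (1/2) (6, 10, 6) = 5121/5792" "eq_banker (1/2) (10, 6, 6) = 5121/5792"
    unfolding eq_banker_mixing by (simp_all add: D_def power2_eq_square)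
  show "eq_value (1/2) = - 16655514960 / (181 * 13^9)"
    by (simp add: eq_value_def D_def)
qed

end
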